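(* Let $f\in C(\Lambda)$ be differentiable in the following sense: there exist $f^0,f^1\in C(\Lambda)$ such that for all $(t,\omega)\in[0,T]\times\mathcal V$ $$f(t,\omega)=f(0,\omega)+\int_0^t f^0(s,\omega)\,ds+\int_0^t f^1(s-,\omega)\,d\omega_s+V(t,\omega),$$ where $$V(t,\omega):=\sum_{s\le t}\big[f(s,\omega)-f(s-,\omega)-f^1(s-,\omega)\Delta\omega_s\big]$$ is of finite variation (in $t$) for all $\omega\in\mathcal V$. Then for all $(t,\omega)\in[0,T)\times D([0,T],\mathbb R)$ the derivatives $\partial_t f(t,\omega)$ and $D_\omega f(t,\omega)$ exist and $$f^0(t,\omega)=\partial_t f(t,\omega)\qquad\text{and}\qquad f^1(t,\omega)=D_\omega f(t,\omega).$$
   Context: Fix $T>0$. $\Omega=D([0,T],\mathbb R)$ is the set of RCLL (right continuous with left limits) paths $\omega:[0,T]\to\mathbb R$, $\Lambda=[0,T]\times\Omega$, and $\mathcal V\subset\Omega$ is the set of RCLL paths of finite variation. For $\omega\in\Omega$, $\omega^t=\omega(\cdot\wedge t)$ is the path stopped at $t$, and $\Delta\omega_t=\omega_t-\omega_{t-}$ (with $\Delta\omega_0=0$). The pseudo-metric on $\Lambda$ is $$d_\infty((t,\omega),(t',\omega'))=|t-t'|+\sup_{0\le s\le T}|\omega_{t\wedge s}-\omega'_{t'\wedge s}|,$$ and $C(\Lambda)=C([0,T]\times\Omega)$ is the set of functionals $f:\Lambda\to\mathbb R$ continuous with respect to $d_\infty$. Any such $f$ is non-anticipative: $f(t,\omega)=f(t,\omega^t)$.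 $f(t-,\omega)$ denotes the left limit $\lim_{s\uparrow t}f(s,\omega)$ (with $f(0-,\omega)=f(0,\omega)$). Integrals $\int_0^t$ with respect to paths are over $(0,t]$. For $t<T$, the horizontal derivative is $$\partial_t f(t,\omega)=\lim_{h\to0,\,h>0}\frac{f(t+h,\omega^t)-f(t,\omega)}{h},$$ and the derivative $D_\omega f$ is $$D_\omega f(t,\omega)=\lim_{h\to0,\,h>0}\frac{f(t+h,\omega^t+\chi_{t,h})-f(t+h,\omega^t)}{h},\qquad \chi_{t,h}(s)=(s-t)1_{(t,t+h]}(s)+h1_{(t+h,T]}(s).$$ *)

theory Defs
  imports "HOL-Analysis.Analysis"
begin

text \<open>
  A path on \<open>[0,T]\<close> is represented by a function on all reals. None of the notions below, used for
  times in \<open>[0,T]\<close>, looks at values of a path outside \<open>[0,T]\<close>; in particular, two paths that agree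
  on \<open>[0,T]\<close> have distance zero and are identified by every continuous functional.
\<close>

type_synonym path = "real \<Rightarrow> real"
type_synonym path_functional = "real \<Rightarrow> path \<Rightarrow> real"

definition rcll_paths :: "real \<Rightarrow> path set" where
  "rcll_paths T = {w. (\<forall>t\<in>{0..<T}. continuous (at_right t) w) \<and>
                      (\<forall>t\<in>{0<..T}. \<exists>l. (w \<longlongrightarrow> l) (at_left t))}"

definition variation_sums :: "real \<Rightarrow> real \<Rightarrow> (real \<Rightarrow> real) \<Rightarrow> real set" where
  "variation_sums a b g =
     {(\<Sum>i<n. \<bar>g (p (Suc i)) - g (p i)\<bar>) |(n::nat) (p::nat \<Rightarrow> real).
        mono_on {..n} p \<and> p ` {..n} \<subseteq> {a..b}}"

definition finite_variation_on :: "real \<Rightarrow> real \<Rightarrow> (real \<Rightarrow> real) \<Rightarrow> bool" where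
  "finite_variation_on a b g \<longleftrightarrow> bdd_above (variation_sums a b g)"

definition total_variation :: "real \<Rightarrow> real \<Rightarrow> (real \<Rightarrow> real) \<Rightarrow> real" where
  "total_variation a b g = Sup (variation_sums a b g)"

definition fv_paths :: "real \<Rightarrow> path set" where
  "fv_paths T = {w \<in> rcll_paths T. finite_variation_on 0 T w}"

definition stopped :: "real \<Rightarrow> path \<Rightarrow> path" where
  "stopped t w = (\<lambda>s. w (min s t))"

text \<open>The convention \<open>g(0-) = g(0)\<close> makes the jump at time \<open>0\<close> vanish.\<close>

definition left_lim :: "(real \<Rightarrow> real) \<Rightarrow> real \<Rightarrow> real" where
  "left_lim g t = (if t = 0 then g 0 else Lim (at_left t) g)"

definition jump :: "(real \<Rightarrow> real) \<Rightarrow> real \<Rightarrow> real" where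
  "jump g t = g t - left_lim g t"

text \<open>
  The Lebesgue--Stieltjes integral over \<open>(0,t]\<close> is taken with respect to the Jordan decomposition
  \<open>w = P - N\<close> with \<open>P = (TV + w) / 2\<close> and \<open>N = (TV - w) / 2\<close>, where \<open>TV\<close> is the variation function
  of \<open>w\<close>. Both parts are nondecreasing on \<open>[0,t]\<close>, and right continuous if \<open>w\<close> is. Clamping the
  argument to \<open>[0,t]\<close> extends them by constants to the whole line, as \<^const>\<open>interval_measure\<close> needs.
\<close>

definition pos_part :: "real \<Rightarrow> path \<Rightarrow> real \<Rightarrow> real" where
  "pos_part t w s = (let u = max 0 (min s t) in (total_variation 0 u w + w u) / 2)"

definition neg_part :: "real \<Rightarrow> path \<Rightarrow> real \<Rightarrow> real" where
  "neg_part t w s = (let u = max 0 (min s t) in (total_variation 0 u w - w u) / 2)"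

definition stieltjes_integral :: "real \<Rightarrow> (real \<Rightarrow> real) \<Rightarrow> path \<Rightarrow> real" where
  "stieltjes_integral t g w =
     (LINT s:{0<..t}|interval_measure (pos_part t w). g s) -
     (LINT s:{0<..t}|interval_measure (neg_part t w). g s)"

text \<open>
  On RCLL paths, which are bounded on \<open>[0,T]\<close>, the supremum is over a bounded set.
\<close>

definition dist_infty :: "real \<Rightarrow> real \<times> path \<Rightarrow> real \<times> path \<Rightarrow> real" where
  "dist_infty T = (\<lambda>(t, w) (t', w').
     \<bar>t - t'\<bar> + (SUP s\<in>{0..T}. \<bar>stopped t w s - stopped t' w' s\<bar>))"

definition continuous_functional :: "real \<Rightarrow> path_functional \<Rightarrow> bool" where
  "continuous_functional T f \<longleftrightarrow>
     (\<forall>t\<in>{0..T}. \<forall>w\<in>rcll_paths T. \<forall>e>0. \<exists>d>0.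
        \<forall>t'\<in>{0..T}. \<forall>w'\<in>rcll_paths T.
          dist_infty T (t, w) (t', w') < d \<longrightarrow> \<bar>f t w - f t' w'\<bar> < e)"

definition has_horizontal_derivative ::
    "path_functional \<Rightarrow> real \<Rightarrow> real \<Rightarrow> path \<Rightarrow> bool" where
  "has_horizontal_derivative f l t w \<longleftrightarrow>
     ((\<lambda>h. (f (t + h) (stopped t w) - f t w) / h) \<longlongrightarrow> l) (at_right 0)"

definition ramp :: "real \<Rightarrow> real \<Rightarrow> real \<Rightarrow> path" where
  "ramp T t h s = (s - t) * indicator {t<..t+h} s + h * indicator {t+h<..T} s"

definition has_path_derivative ::
    "real \<Rightarrow> path_functional \<Rightarrow> real \<Rightarrow> real \<Rightarrow> path \<Rightarrow> bool" where
  "has_path_derivative T f l t w \<longleftrightarrow>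
     ((\<lambda>h. (f (t + h) (\<lambda>s. stopped t w s + ramp T t h s) - f (t + h) (stopped t w)) / h)
        \<longlongrightarrow> l) (at_right 0)"

definition jump_remainder :: "path_functional \<Rightarrow> path_functional \<Rightarrow> path \<Rightarrow> real \<Rightarrow> real" where
  "jump_remainder f f1 w s =
     f s w - left_lim (\<lambda>u. f u w) s - left_lim (\<lambda>u. f1 u w) s * jump w s"

definition jump_sum :: "path_functional \<Rightarrow> path_functional \<Rightarrow> real \<Rightarrow> path \<Rightarrow> real" where
  "jump_sum f f1 t w = (\<Sum>\<^sub>\<infinity>s\<in>{0..t}. jump_remainder f f1 w s)"

end

theory Submission
  imports Defs
begin

text \<open>
  Fix \<open>(t,w)\<close> with \<open>t < T\<close>. Let \<open>v\<close> be a path of finite variation that is continuous and nondecreasing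
  after \<open>t\<close>. Then \<open>v\<close> has no jumps in \<open>(t,t+h]\<close>, so neither has \<open>f\<close> along \<open>v\<close>, and the change of
  variable formulas at \<open>t\<close> and at \<open>t+h\<close> differ by the integral of \<open>f0\<close> over \<open>(t,t+h]\<close> against time
  and the integral of \<open>f1\<close> against \<open>v\<close>. If \<open>v\<close> stays close to \<open>w\<close> stopped at \<open>t\<close>, the integrands are
  close to \<open>f0(t,w)\<close> and \<open>f1(t,w)\<close> by continuity, so \<open>f(t+h,v) - f(t,v)\<close> equals
  \<open>f0(t,w) h + f1(t,w) (v(t+h) - v(t))\<close> up to an error of at most \<open>e (h + v(t+h) - v(t))\<close>
  (lemma \<open>functional_increment_estimate\<close>). Constancy of \<open>v\<close> after \<open>t\<close> gives the horizontal
  derivative. A ramp of slope one gives the sum of both derivatives, and subtracting the constant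
  case leaves \<open>f1\<close>.

  A general RCLL path \<open>w\<close> does not have finite variation, but it is a uniform limit of step paths
  (\<open>rcll_path_step_approx\<close>). The error bound above holds uniformly for all step paths near \<open>w\<close>, and
  both sides of it depend on the step path only through values of \<open>f\<close>, which is continuous. The
  estimate therefore passes to \<open>w\<close> itself (\<open>rcll_path_increment_estimate\<close>).

  Working with step paths, to which a continuous nondecreasing function may be added, also keeps the
  Stieltjes integrals elementary. Such a path is nondecreasing immediately to the right of each time,
  so its variation function is right continuous without further argument, and functionals along it
  are continuous off finitely many times, so all integrands are bounded and measurable.
\<close>

section \<open>Regulated paths and step paths\<close>

lemma rcll_path_right:
  assumes "w \<in> rcll_paths T" "0 \<le> s" "s < T"
  shows "(w \<longlongrightarrow> w s) (at_right s)"
  using assms by (auto simp: rcll_paths_def continuous_within)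

lemma rcll_path_left:
  assumes "w \<in> rcll_paths T" "0 < s" "s \<le> T"
  obtains l where "(w \<longlongrightarrow> l) (at_left s)"
proof -
  have "s \<in> {0<..T}" using assms by simp
  then have "\<exists>l. (w \<longlongrightarrow> l) (at_left s)"
    using assms(1) unfolding rcll_paths_def by blast
  then show ?thesis using that by blast
qed

lemma rcll_pathI:
  assumes "\<And>s. 0 \<le> s \<Longrightarrow> s < T \<Longrightarrow> (w \<longlongrightarrow> w s) (at_right s)"
    and "\<And>s. 0 < s \<Longrightarrow> s \<le> T \<Longrightarrow> \<exists>l. (w \<longlongrightarrow> l) (at_left s)"
  shows "w \<in> rcll_paths T"
  using assms by (auto simp: rcll_paths_def continuous_within)

lemma rcll_path_cong:
  assumes w: "w \<in> rcll_paths T" and eq: "\<And>s. 0 \<le> s \<Longrightarrow> s \<le> T \<Longrightarrow> w s = w' s"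
  shows "w' \<in> rcll_paths T"
proof (rule rcll_pathI)
  fix s assume s: "0 \<le> s" "s < T"
  have "\<forall>\<^sub>F x in at_right s. x \<in> {s<..<T}"
    using s by (intro eventually_at_right_real) auto
  then have "\<forall>\<^sub>F x in at_right s. w x = w' x"
    by eventually_elim (use s eq in auto)
  then show "(w' \<longlongrightarrow> w' s) (at_right s)"
    using Lim_transform_eventually[OF rcll_path_right[OF w s]] eq[of s] s by simp
next
  fix s assume s: "0 < s" "s \<le> T"
  obtain l where l: "(w \<longlongrightarrow> l) (at_left s)"
    using rcll_path_left[OF w s] by blast
  have "\<forall>\<^sub>F x in at_left s. x \<in> {0<..<s}"
    using s by (intro eventually_at_left_real) auto
  then have "\<forall>\<^sub>F x in at_left s. w x = w' x"
    by eventually_elim (use s eq in auto)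
  then show "\<exists>l. (w' \<longlongrightarrow> l) (at_left s)"
    using Lim_transform_eventually[OF l] by blast
qed

lemma rcll_path_add:
  assumes "v \<in> rcll_paths T" "w \<in> rcll_paths T"
  shows "(\<lambda>s. v s + w s) \<in> rcll_paths T"
proof (rule rcll_pathI)
  fix s assume s: "0 < s" "s \<le> T"
  obtain l where l: "(v \<longlongrightarrow> l) (at_left s)"
    using rcll_path_left[OF assms(1) s] by blast
  obtain m where m: "(w \<longlongrightarrow> m) (at_left s)"
    using rcll_path_left[OF assms(2) s] by blast
  show "\<exists>l. ((\<lambda>s. v s + w s) \<longlongrightarrow> l) (at_left s)"
    using tendsto_add[OF l m] by blast
qed (use assms in \<open>auto intro!: tendsto_add dest: rcll_path_right\<close>)

lemma rcll_path_continuous: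
  assumes "\<And>s. isCont w s"
  shows "w \<in> rcll_paths T"
  using assms by (intro rcll_pathI) (auto simp: isCont_def filterlim_at_split)

lemma rcll_path_stopped:
  assumes w: "w \<in> rcll_paths T" and "0 \<le> t" "t \<le> T"
  shows "stopped t w \<in> rcll_paths T"
proof (rule rcll_pathI)
  fix s assume s: "0 \<le> s" "s < T"
  show "(stopped t w \<longlongrightarrow> stopped t w s) (at_right s)"
  proof (cases "s < t")
    case True
    then have "\<forall>\<^sub>F x in at_right s. x \<in> {s<..<t}"
      by (intro eventually_at_right_real) auto
    then have "\<forall>\<^sub>F x in at_right s. w x = stopped t w x"
      by eventually_elim (auto simp: stopped_def)
    then show ?thesis
      using Lim_transform_eventually[OF rcll_path_right[OF w s]] True by (simp add: stopped_def)
  next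
    case False
    then have "\<forall>\<^sub>F x in at_right s. stopped t w s = stopped t w x"
      by (auto simp: stopped_def eventually_at_filter)
    then show ?thesis
      using Lim_transform_eventually[OF tendsto_const] by blast
  qed
next
  fix s assume s: "0 < s" "s \<le> T"
  show "\<exists>l. (stopped t w \<longlongrightarrow> l) (at_left s)"
  proof (cases "s \<le> t")
    case True
    obtain l where l: "(w \<longlongrightarrow> l) (at_left s)"
      using rcll_path_left[OF w s] by blast
    have "\<forall>\<^sub>F x in at_left s. w x = stopped t w x"
      using True by (auto simp: stopped_def eventually_at_filter)
    then show ?thesis
      using Lim_transform_eventually[OF l] by blast
  next
    case False
    then have "\<forall>\<^sub>F x in at_left s. x \<in> {t<..<s}"
      by (intro eventually_at_left_real) auto
    then have "\<forall>\<^sub>F x in at_left s. w t = stopped t w x"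
      by eventually_elim (auto simp: stopped_def)
    then show ?thesis
      using Lim_transform_eventually[OF tendsto_const] by blast
  qed
qed

lemma rcll_path_local_oscillation:
  assumes w: "w \<in> rcll_paths T" and x: "0 \<le> x" "x \<le> T" and "e > 0"
  obtains d l where "d > 0"
    "\<And>s. x \<le> s \<Longrightarrow> s < x + d \<Longrightarrow> s \<le> T \<Longrightarrow> \<bar>w x - w s\<bar> < e"
    "\<And>s. x - d < s \<Longrightarrow> s < x \<Longrightarrow> 0 \<le> s \<Longrightarrow> \<bar>l - w s\<bar> < e"
proof -
  obtain d1 where 1: "d1 > 0" "\<And>s. x \<le> s \<Longrightarrow> s < x + d1 \<Longrightarrow> s \<le> T \<Longrightarrow> \<bar>w x - w s\<bar> < e"
  proof (cases "x < T")
    case True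
    from rcll_path_right[OF w \<open>0 \<le> x\<close> True]
    have "\<forall>\<^sub>F s in at_right x. \<bar>w s - w x\<bar> < e"
      using \<open>e > 0\<close> by (auto simp: tendsto_iff dist_real_def)
    then obtain b where b: "b > x" "\<And>s. x < s \<Longrightarrow> s < b \<Longrightarrow> \<bar>w s - w x\<bar> < e"
      by (auto simp: eventually_at_right_field)
    have "\<bar>w x - w s\<bar> < e" if "x \<le> s" "s < x + (b - x)" for s
      using b(2)[of s] that \<open>e > 0\<close> by (cases "s = x") auto
    then show ?thesis using that[of "b - x"] b(1) by simp
  next
    case False
    then show ?thesis using \<open>e > 0\<close> \<open>x \<le> T\<close> by (intro that[of 1]) auto
  qed
  obtain d2 l where 2: "d2 > 0" "\<And>s. x - d2 < s \<Longrightarrow> s < x \<Longrightarrow> 0 \<le> s \<Longrightarrow> \<bar>l - w s\<bar> < e"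
  proof (cases "0 < x")
    case True
    obtain l where l: "(w \<longlongrightarrow> l) (at_left x)"
      using rcll_path_left[OF w True \<open>x \<le> T\<close>] by blast
    then have "\<forall>\<^sub>F s in at_left x. \<bar>w s - l\<bar> < e"
      using \<open>e > 0\<close> by (auto simp: tendsto_iff dist_real_def)
    then obtain b where b: "b < x" "\<And>s. b < s \<Longrightarrow> s < x \<Longrightarrow> \<bar>w s - l\<bar> < e"
      by (auto simp: eventually_at_left_field)
    then show ?thesis using that[of "x - b" l] by (simp add: abs_minus_commute)
  next
    case False
    then show ?thesis by (intro that[of 1]) auto
  qed
  show ?thesis
    by (rule that[of "min d1 d2" l]) (use 1 2 in auto)
qed

text \<open>
  Compactness of \<open>[0,T]\<close>, in the form of bisection: a property of intervals that passes to
  adjacent unions and holds near every point holds for \<open>[0,T]\<close>. Bisection also meets intervals that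
  stick out of \<open>[0,T]\<close>, hence the intersection with the fixed set \<open>I\<close>.
\<close>

lemma rcll_path_bounded:
  assumes w: "w \<in> rcll_paths T" and "0 \<le> T"
  obtains B where "\<And>s. 0 \<le> s \<Longrightarrow> s \<le> T \<Longrightarrow> \<bar>w s\<bar> \<le> B"
proof -
  define I where "I = {0..T}"
  have "\<exists>B. \<forall>s\<in>{0..T} \<inter> I. \<bar>w s\<bar> \<le> B"
    using \<open>0 \<le> T\<close>
  proof (induction rule: Bolzano)
    case (trans a b c)
    then obtain B C where BC: "\<forall>s\<in>{a..b} \<inter> I. \<bar>w s\<bar> \<le> B" "\<forall>s\<in>{b..c} \<inter> I. \<bar>w s\<bar> \<le> C"
      by blast
    have "\<bar>w s\<bar> \<le> max B C" if "s \<in> {a..c} \<inter> I" for s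
      using BC that by (cases "s \<le> b") (auto simp: le_max_iff_disj)
    then show ?case by (intro exI[of _ "max B C"] ballI)
  next
    case (local x)
    obtain d l where d: "d > 0" "\<And>s. x \<le> s \<Longrightarrow> s < x + d \<Longrightarrow> s \<le> T \<Longrightarrow> \<bar>w x - w s\<bar> < 1"
      "\<And>s. x - d < s \<Longrightarrow> s < x \<Longrightarrow> 0 \<le> s \<Longrightarrow> \<bar>l - w s\<bar> < 1"
      using rcll_path_local_oscillation[OF w local zero_less_one] by blast
    have "\<bar>w s\<bar> \<le> \<bar>w x\<bar> + \<bar>l\<bar> + 1"
      if "a \<le> x" "x \<le> b" "b - a < d" "s \<in> {a..b} \<inter> I" for a b s
      using d(2)[of s] d(3)[of s] that unfolding I_def by (cases "x \<le> s") auto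
    then show ?case
      using d(1) by blast
  qed
  then obtain B where "\<forall>s\<in>{0..T}. \<bar>w s\<bar> \<le> B"
    unfolding I_def by blast
  then show ?thesis by (intro that[of B]) simp
qed

text \<open>
  The set \<open>F\<close> contains all times at which \<open>u\<close> may change. Expressing a step function by its
  constancy between break points, not by a partition and a list of values, makes stopping and gluing
  two step functions immediate.
\<close>

definition step_path :: "real set \<Rightarrow> path \<Rightarrow> bool" where
  "step_path F u \<longleftrightarrow> finite F \<and> (\<forall>x y. x \<le> y \<longrightarrow> {x<..y} \<inter> F = {} \<longrightarrow> u x = u y)"

lemma step_pathD: "step_path F u \<Longrightarrow> x \<le> y \<Longrightarrow> {x<..y} \<inter> F = {} \<Longrightarrow> u x = u y"
  by (simp add: step_path_def)

lemma step_path_right: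
  assumes "step_path F u"
  shows "\<exists>d>0. \<forall>y\<in>{x..x + d}. u y = u x"
proof -
  obtain d where d: "d > 0" "\<forall>y\<in>F. y \<noteq> x \<longrightarrow> d \<le> dist x y"
    using finite_set_avoid[of F x] assms by (auto simp: step_path_def)
  have "u y = u x" if "y \<in> {x..x + d / 2}" for y
  proof -
    have "z \<notin> F" if "x < z" "z \<le> y" for z
      using d(1) bspec[OF d(2), of z] that \<open>y \<in> {x..x + d / 2}\<close> by (auto simp: dist_real_def)
    then have "u x = u y"
      using that by (intro step_pathD[OF assms]) auto
    then show ?thesis by simp
  qed
  then have "\<forall>y\<in>{x..x + d / 2}. u y = u x" by (rule ballI)
  moreover have "d / 2 > 0" using d(1) by simp
  ultimately show ?thesis by (intro exI[of _ "d / 2"] conjI)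
qed

lemma step_path_left:
  assumes "step_path F u"
  shows "\<exists>d>0. \<exists>c. (\<forall>y\<in>{x - d..<x}. u y = c) \<and> (x \<notin> F \<longrightarrow> u x = c)"
proof -
  obtain d where d: "d > 0" "\<forall>y\<in>F. y \<noteq> x \<longrightarrow> d \<le> dist x y"
    using finite_set_avoid[of F x] assms by (auto simp: step_path_def)
  have *: "u (x - d / 2) = u y" if "x - d / 2 \<le> y" "y < x \<or> y = x \<and> x \<notin> F" for y
  proof -
    have "z \<notin> F" if "x - d / 2 < z" "z \<le> y" for z
      using d(1) bspec[OF d(2), of z] that \<open>y < x \<or> y = x \<and> x \<notin> F\<close> by (auto simp: dist_real_def)
    then show ?thesis
      using that by (intro step_pathD[OF assms]) auto
  qed
  have "\<forall>y\<in>{x - d / 2..<x}. u y = u (x - d / 2)"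
  proof
    show "u y = u (x - d / 2)" if "y \<in> {x - d / 2..<x}" for y
      using *[of y] that by simp
  qed
  moreover have "x \<notin> F \<longrightarrow> u x = u (x - d / 2)"
    using *[of x] d(1) by simp
  moreover have "d / 2 > 0" using d(1) by simp
  ultimately show ?thesis by blast
qed

lemma step_path_right_limit:
  assumes "step_path F u"
  shows "(u \<longlongrightarrow> u x) (at_right x)"
  using step_path_right[OF assms, of x]
proof (elim exE conjE)
  fix d :: real assume d: "d > 0" "\<forall>y\<in>{x..x + d}. u y = u x"
  have "\<forall>\<^sub>F y in at_right x. y \<in> {x<..<x + d}"
    using d(1) by (intro eventually_at_right_real) simp
  then have "\<forall>\<^sub>F y in at_right x. u x = u y"
    by eventually_elim (rule d(2)[THEN bspec, symmetric], auto)
  then show ?thesis by (rule Lim_transform_eventually[OF tendsto_const])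
qed

lemma step_path_left_limit:
  assumes "step_path F u"
  shows "\<exists>c. (u \<longlongrightarrow> c) (at_left x) \<and> (x \<notin> F \<longrightarrow> u x = c)"
  using step_path_left[OF assms, of x]
proof (elim exE conjE)
  fix d c :: real
  assume d: "d > 0" "\<forall>y\<in>{x - d..<x}. u y = c" "x \<notin> F \<longrightarrow> u x = c"
  have "\<forall>\<^sub>F y in at_left x. y \<in> {x - d<..<x}"
    using d(1) by (intro eventually_at_left_real) simp
  then have "\<forall>\<^sub>F y in at_left x. c = u y"
    by eventually_elim (rule d(2)[THEN bspec, symmetric], auto)
  then have "(u \<longlongrightarrow> c) (at_left x)"
    by (rule Lim_transform_eventually[OF tendsto_const])
  then show ?thesis using d(3) by (intro exI[of _ c] conjI)
qed

lemma step_path_rcll: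
  assumes "step_path F u"
  shows "u \<in> rcll_paths T"
proof (rule rcll_pathI)
  show "\<exists>l. (u \<longlongrightarrow> l) (at_left s)" for s
    using step_path_left_limit[OF assms, of s] by blast
qed (rule step_path_right_limit[OF assms])

lemma step_path_stopped:
  assumes "step_path F u"
  shows "step_path (F \<inter> {..t}) (stopped t u)"
  unfolding step_path_def stopped_def
proof (intro conjI allI impI)
  fix x y :: real assume "x \<le> y" "{x<..y} \<inter> (F \<inter> {..t}) = {}"
  then have "min x t \<le> min y t" "{min x t<..min y t} \<inter> F = {}"
    by (auto simp: min_less_iff_disj disjoint_iff)
  then show "u (min x t) = u (min y t)" by (rule step_pathD[OF assms])
qed (use assms in \<open>auto simp: step_path_def\<close>)

lemma step_path_glue:
  assumes "step_path F u" "step_path G v"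
  shows "step_path (insert b (F \<union> G)) (\<lambda>s. if s < b then u s else v s)"
  unfolding step_path_def
proof (intro conjI allI impI)
  fix x y :: real assume *: "x \<le> y" "{x<..y} \<inter> insert b (F \<union> G) = {}"
  have "u x = u y" "v x = v y"
    using * by (auto intro!: step_pathD[OF assms(1)] step_pathD[OF assms(2)])
  moreover have "x < b \<longleftrightarrow> y < b" using * by auto
  ultimately show "(if x < b then u x else v x) = (if y < b then u y else v y)" by simp
qed (use assms in \<open>auto simp: step_path_def\<close>)

lemma step_path_const: "step_path {} (\<lambda>_. c)"
  by (simp add: step_path_def)

text \<open>
  Next to a time \<open>x\<close>, an RCLL path stays close to its left limit before \<open>x\<close> and to its value at
  \<open>x\<close> from then on, so a step path with the single break point \<open>x\<close> approximates it there. Finitely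
  many of these pieces cover \<open>[0,T]\<close> and are glued.
\<close>

lemma rcll_path_step_approx:
  assumes w: "w \<in> rcll_paths T" and "0 \<le> T" "e > 0"
  obtains F u where "step_path F u" "\<And>s. 0 \<le> s \<Longrightarrow> s \<le> T \<Longrightarrow> \<bar>u s - w s\<bar> < e"
proof -
  define I where "I = {0..T}"
  have "\<exists>F u. step_path F u \<and> (\<forall>s\<in>{0..T} \<inter> I. \<bar>u s - w s\<bar> < e)"
    using \<open>0 \<le> T\<close>
  proof (induction rule: Bolzano)
    case (trans a b c)
    then obtain F u G v where "step_path F u" "\<forall>s\<in>{a..b} \<inter> I. \<bar>u s - w s\<bar> < e"
      and "step_path G v" "\<forall>s\<in>{b..c} \<inter> I. \<bar>v s - w s\<bar> < e"
      by blast
    then have "step_path (insert b (F \<union> G)) (\<lambda>s. if s < b then u s else v s)"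
      and "\<forall>s\<in>{a..c} \<inter> I. \<bar>(if s < b then u s else v s) - w s\<bar> < e"
      by (auto intro: step_path_glue)
    then show ?case by blast
  next
    case (local x)
    obtain d l where d: "d > 0" "\<And>s. x \<le> s \<Longrightarrow> s < x + d \<Longrightarrow> s \<le> T \<Longrightarrow> \<bar>w x - w s\<bar> < e"
      "\<And>s. x - d < s \<Longrightarrow> s < x \<Longrightarrow> 0 \<le> s \<Longrightarrow> \<bar>l - w s\<bar> < e"
      using rcll_path_local_oscillation[OF w local \<open>e > 0\<close>] by blast
    have "step_path {x} (\<lambda>s. if s < x then l else w x)"
      using step_path_glue[OF step_path_const step_path_const] by simp
    moreover have "\<bar>(if s < x then l else w x) - w s\<bar> < e"
      if "a \<le> x" "x \<le> b" "b - a < d" "s \<in> {a..b} \<inter> I" for a b s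
      using d(2)[of s] d(3)[of s] that unfolding I_def by auto
    ultimately show ?case
      using d(1) by blast
  qed
  then obtain F u where "step_path F u" "\<forall>s\<in>{0..T}. \<bar>u s - w s\<bar> < e"
    unfolding I_def by blast
  then show ?thesis by (intro that[of F u]) auto
qed

section \<open>Functionals along a path\<close>

text \<open>
  Continuity at \<open>(t,w)\<close> in terms of pointwise bounds. These are easier to supply
  than bounds on the supremum in the pseudo-metric.
\<close>

lemma continuous_functionalD:
  assumes f: "continuous_functional T f" and "0 \<le> T" and t: "t \<in> {0..T}" and w: "w \<in> rcll_paths T"
    and "e > 0"
  obtains d where "d > 0"
    "\<And>t' w'. t' \<in> {0..T} \<Longrightarrow> w' \<in> rcll_paths T \<Longrightarrow> \<bar>t' - t\<bar> \<le> d \<Longrightarrow>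
      (\<And>x. 0 \<le> x \<Longrightarrow> x \<le> T \<Longrightarrow> \<bar>w' (min x t') - w (min x t)\<bar> \<le> d) \<Longrightarrow> \<bar>f t' w' - f t w\<bar> < e"
proof -
  have "\<exists>d>0. \<forall>t'\<in>{0..T}. \<forall>w'\<in>rcll_paths T.
      dist_infty T (t, w) (t', w') < d \<longrightarrow> \<bar>f t w - f t' w'\<bar> < e"
    using f t w \<open>e > 0\<close> unfolding continuous_functional_def by simp
  then obtain d where d: "d > 0" "\<And>t' w'. t' \<in> {0..T} \<Longrightarrow> w' \<in> rcll_paths T \<Longrightarrow>
      dist_infty T (t, w) (t', w') < d \<Longrightarrow> \<bar>f t w - f t' w'\<bar> < e"
    by meson
  have "\<bar>f t' w' - f t w\<bar> < e"
    if *: "t' \<in> {0..T}" "w' \<in> rcll_paths T" "\<bar>t' - t\<bar> \<le> d / 3"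
      "\<And>x. 0 \<le> x \<Longrightarrow> x \<le> T \<Longrightarrow> \<bar>w' (min x t') - w (min x t)\<bar> \<le> d / 3" for t' w'
  proof -
    have "(SUP s\<in>{0..T}. \<bar>stopped t w s - stopped t' w' s\<bar>) \<le> d / 3"
      using \<open>0 \<le> T\<close> *(4) by (intro cSUP_least) (auto simp: stopped_def abs_minus_commute)
    then have "dist_infty T (t, w) (t', w') < d"
      using *(3) d(1) abs_minus_commute[of t t'] unfolding dist_infty_def by simp
    then show ?thesis using d(2)[OF *(1,2)] by (simp add: abs_minus_commute)
  qed
  then show ?thesis using that[of "d / 3"] d(1) by auto
qed

text \<open>
  Two paths that agree up to time \<open>t\<close> have distance \<open>0\<close> at time \<open>t\<close>.
\<close>

lemma functional_nonanticipative:
  assumes f: "continuous_functional T f" and t: "t \<in> {0..T}"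
    and w: "w \<in> rcll_paths T" "w' \<in> rcll_paths T"
    and eq: "\<And>x. 0 \<le> x \<Longrightarrow> x \<le> t \<Longrightarrow> w' x = w x"
  shows "f t w' = f t w"
proof -
  have "\<bar>f t w' - f t w\<bar> \<le> 0 + e" if "e > 0" for e
  proof -
    have "0 \<le> T" using t by auto
    obtain d where d: "d > 0" "\<And>t' w'. t' \<in> {0..T} \<Longrightarrow> w' \<in> rcll_paths T \<Longrightarrow> \<bar>t' - t\<bar> \<le> d \<Longrightarrow>
      (\<And>x. 0 \<le> x \<Longrightarrow> x \<le> T \<Longrightarrow> \<bar>w' (min x t') - w (min x t)\<bar> \<le> d) \<Longrightarrow> \<bar>f t' w' - f t w\<bar> < e"
      using continuous_functionalD[OF f \<open>0 \<le> T\<close> t w(1) \<open>e > 0\<close>] by blast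
    have "\<bar>f t w' - f t w\<bar> < e"
      using d(1) t eq by (intro d(2)) (auto simp: w)
    then show ?thesis by simp
  qed
  then have "\<bar>f t w' - f t w\<bar> \<le> 0" by (rule field_le_epsilon)
  then show ?thesis by simp
qed

lemma functional_along_path_right:
  assumes f: "continuous_functional T f" and w: "w \<in> rcll_paths T" and s: "0 \<le> s" "s < T"
  shows "((\<lambda>r. f r w) \<longlongrightarrow> f s w) (at_right s)"
proof (rule tendstoI)
  fix e :: real assume "e > 0"
  have "0 \<le> T" "s \<in> {0..T}" using s by auto
  then obtain d where d: "d > 0"
    "\<And>r w'. r \<in> {0..T} \<Longrightarrow> w' \<in> rcll_paths T \<Longrightarrow> \<bar>r - s\<bar> \<le> d \<Longrightarrow>
      (\<And>x. 0 \<le> x \<Longrightarrow> x \<le> T \<Longrightarrow> \<bar>w' (min x r) - w (min x s)\<bar> \<le> d) \<Longrightarrow> \<bar>f r w' - f s w\<bar> < e"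
    using continuous_functionalD[OF f _ _ w \<open>e > 0\<close>, of s] by blast
  have "\<forall>\<^sub>F x in at_right s. \<bar>w x - w s\<bar> < d"
    using rcll_path_right[OF w s] d(1) by (auto simp: tendsto_iff dist_real_def)
  then obtain b where b: "b > s" "\<And>x. s < x \<Longrightarrow> x < b \<Longrightarrow> \<bar>w x - w s\<bar> < d"
    by (auto simp: eventually_at_right_field)
  have "\<forall>\<^sub>F r in at_right s. r \<in> {s<..<min T (min b (s + d))}"
    using b(1) s d(1) by (intro eventually_at_right_real) auto
  then show "\<forall>\<^sub>F r in at_right s. dist (f r w) (f s w) < e"
  proof eventually_elim
    case (elim r)
    have "\<bar>w (min x r) - w (min x s)\<bar> \<le> d" for x
    proof (cases "x \<le> s")
      case False
      then have "s < min x r" "min x r < b" "min x s = s" using elim by auto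
      then show ?thesis using b(2)[of "min x r"] by simp
    qed (use elim d(1) in auto)
    then have "\<bar>f r w - f s w\<bar> < e"
      using elim s by (intro d(2)[OF _ w]) auto
    then show ?case by (simp add: dist_real_def)
  qed
qed

text \<open>
  As \<open>r\<close> increases to \<open>s\<close>, the path stopped at \<open>r\<close> converges uniformly to the path that follows
  \<open>w\<close> before \<open>s\<close> and stays at its left limit from \<open>s\<close> on, that is, to \<open>w\<close> with its jump at \<open>s\<close>
  suppressed.
\<close>

lemma functional_along_path_left:
  assumes f: "continuous_functional T f" and w: "w \<in> rcll_paths T" and s: "0 < s" "s \<le> T"
    and l: "(w \<longlongrightarrow> l) (at_left s)"
  shows "((\<lambda>r. f r w) \<longlongrightarrow> f s (\<lambda>x. if x < s then w x else l)) (at_left s)"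
proof (rule tendstoI)
  fix e :: real assume "e > 0"
  define v where "v = (\<lambda>x. if x < s then w x else l)"
  have v: "v \<in> rcll_paths T"
  proof (rule rcll_pathI)
    fix x assume x: "0 \<le> x" "x < T"
    show "(v \<longlongrightarrow> v x) (at_right x)"
    proof (cases "x < s")
      case True
      then have "\<forall>\<^sub>F y in at_right x. y \<in> {x<..<s}"
        by (intro eventually_at_right_real) auto
      then have "\<forall>\<^sub>F y in at_right x. w y = v y"
        by eventually_elim (auto simp: v_def)
      then show ?thesis
        using Lim_transform_eventually[OF rcll_path_right[OF w x]] True by (simp add: v_def)
    next
      case False
      then have "\<forall>\<^sub>F y in at_right x. l = v y"
        by (auto simp: v_def eventually_at_filter)
      then show ?thesis
        using Lim_transform_eventually[OF tendsto_const] False by (fastforce simp: v_def)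
    qed
  next
    fix x assume x: "0 < x" "x \<le> T"
    show "\<exists>c. (v \<longlongrightarrow> c) (at_left x)"
    proof (cases "x \<le> s")
      case True
      obtain c where c: "(w \<longlongrightarrow> c) (at_left x)"
        using rcll_path_left[OF w x] by blast
      have "\<forall>\<^sub>F y in at_left x. w y = v y"
        using True by (auto simp: v_def eventually_at_filter)
      then show ?thesis
        using Lim_transform_eventually[OF c] by blast
    next
      case False
      then have "\<forall>\<^sub>F y in at_left x. y \<in> {s<..<x}"
        by (intro eventually_at_left_real) auto
      then have "\<forall>\<^sub>F y in at_left x. l = v y"
        by eventually_elim (auto simp: v_def)
      then show ?thesis
        using Lim_transform_eventually[OF tendsto_const] by blast
    qed
  qed
  have "0 \<le> T" "s \<in> {0..T}" using s by auto
  then obtain d where d: "d > 0"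
    "\<And>r w'. r \<in> {0..T} \<Longrightarrow> w' \<in> rcll_paths T \<Longrightarrow> \<bar>r - s\<bar> \<le> d \<Longrightarrow>
      (\<And>x. 0 \<le> x \<Longrightarrow> x \<le> T \<Longrightarrow> \<bar>w' (min x r) - v (min x s)\<bar> \<le> d) \<Longrightarrow> \<bar>f r w' - f s v\<bar> < e"
    using continuous_functionalD[OF f _ _ v \<open>e > 0\<close>, of s] by blast
  have "\<forall>\<^sub>F x in at_left s. \<bar>w x - l\<bar> < d / 2"
    using tendstoD[OF l, of "d / 2"] d(1) by (simp add: dist_real_def)
  then obtain b where b: "b < s" "\<And>x. b < x \<Longrightarrow> x < s \<Longrightarrow> \<bar>w x - l\<bar> < d / 2"
    by (auto simp: eventually_at_left_field)
  have "\<forall>\<^sub>F r in at_left s. r \<in> {max 0 (max b (s - d))<..<s}"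
    using b(1) s d(1) by (intro eventually_at_left_real) auto
  then show "\<forall>\<^sub>F r in at_left s. dist (f r w) (f s (\<lambda>x. if x < s then w x else l)) < e"
  proof eventually_elim
    case (elim r)
    have "\<bar>w (min x r) - v (min x s)\<bar> \<le> d" for x
    proof (cases "x \<le> r")
      case True
      then show ?thesis using elim d(1) by (auto simp: v_def)
    next
      case False
      then have "\<bar>w r - l\<bar> < d / 2" "x < s \<Longrightarrow> \<bar>w x - l\<bar> < d / 2"
        using b(2)[of r] b(2)[of x] elim by auto
      then have "\<bar>w r - v (min x s)\<bar> \<le> d"
        using d(1) abs_triangle_ineq4[of "w r - l" "w x - l"] by (cases "x < s") (auto simp: v_def)
      then show ?thesis using False by simp
    qed
    then have "\<bar>f r w - f s v\<bar> < e"
      using elim s by (intro d(2)[OF _ w]) auto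
    then show ?case by (simp add: dist_real_def v_def)
  qed
qed

text \<open>
  Without a jump at \<open>s\<close>, the limit path above is \<open>w\<close> stopped at \<open>s\<close>.
\<close>

lemma functional_along_path_left_continuous:
  assumes f: "continuous_functional T f" and w: "w \<in> rcll_paths T" and s: "0 < s" "s \<le> T"
    and l: "(w \<longlongrightarrow> w s) (at_left s)"
  shows "((\<lambda>r. f r w) \<longlongrightarrow> f s w) (at_left s)"
proof -
  let ?v = "\<lambda>x. if x < s then w x else w s"
  have "?v = stopped s w" by (auto simp: stopped_def min_def)
  then have "f s ?v = f s w"
    using s rcll_path_stopped[OF w, of s]
    by (intro functional_nonanticipative[OF f _ w]) auto
  then show ?thesis using functional_along_path_left[OF f w s l] by simp
qed

lemma functional_along_path_rcll:
  assumes f: "continuous_functional T f" and w: "w \<in> rcll_paths T"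
  shows "(\<lambda>s. f s w) \<in> rcll_paths T"
proof (rule rcll_pathI)
  fix s assume s: "0 < s" "s \<le> T"
  obtain l where "(w \<longlongrightarrow> l) (at_left s)"
    using rcll_path_left[OF w s] by blast
  then show "\<exists>l. ((\<lambda>s. f s w) \<longlongrightarrow> l) (at_left s)"
    using functional_along_path_left[OF f w s] by blast
qed (rule functional_along_path_right[OF f w])

section \<open>Variation\<close>

lemma variation_sumsI:
  assumes "mono_on {..n} p" "p ` {..n} \<subseteq> {a..b}"
  shows "(\<Sum>i<n. \<bar>g (p (Suc i)) - g (p i)\<bar>) \<in> variation_sums a b g"
  using assms unfolding variation_sums_def by blast

lemma variation_sumsE:
  assumes "S \<in> variation_sums a b g"
  obtains n p where "mono_on {..n} p" "\<And>i. i \<le> n \<Longrightarrow> a \<le> p i \<and> p i \<le> b"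
    "S = (\<Sum>i<n. \<bar>g (p (Suc i)) - g (p i)\<bar>)"
proof -
  obtain n p where *: "mono_on {..n} p" "p ` {..n} \<subseteq> {a..b}"
    "S = (\<Sum>i<n. \<bar>g (p (Suc i)) - g (p i)\<bar>)"
    using assms unfolding variation_sums_def by blast
  from *(2) have "a \<le> p i \<and> p i \<le> b" if "i \<le> n" for i using that by auto
  then show ?thesis using that * by blast
qed

lemma variation_sums_increment:
  assumes "a \<le> b"
  shows "\<bar>g b - g a\<bar> \<in> variation_sums a b g"
proof -
  let ?p = "\<lambda>i::nat. if i = 0 then a else b"
  have "(\<Sum>i<1. \<bar>g (?p (Suc i)) - g (?p i)\<bar>) \<in> variation_sums a b g"
    using assms by (intro variation_sumsI) (auto simp: monotone_on_def)
  then show ?thesis by simp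
qed

lemma variation_sums_mono:
  assumes "a' \<le> a" "b \<le> b'"
  shows "variation_sums a b g \<subseteq> variation_sums a' b' g"
  using assms unfolding variation_sums_def by force

text \<open>
  Truncating all partition points at \<open>b\<close>, from above and from below, yields partitions of \<open>[a,b]\<close>
  and \<open>[b,c]\<close>. An increment across \<open>b\<close> is bounded by the triangle inequality; every other increment
  survives unchanged in one of the two sums.
\<close>

lemma variation_sums_split:
  assumes "S \<in> variation_sums a c g" "a \<le> b" "b \<le> c"
  obtains S1 S2 where "S1 \<in> variation_sums a b g" "S2 \<in> variation_sums b c g" "S \<le> S1 + S2"
proof -
  obtain n p where p: "mono_on {..n} p" "\<And>i. i \<le> n \<Longrightarrow> a \<le> p i \<and> p i \<le> c"
    and S: "S = (\<Sum>i<n. \<bar>g (p (Suc i)) - g (p i)\<bar>)"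
    using variation_sumsE[OF assms(1)] by blast
  define p1 where "p1 i = min (p i) b" for i
  define p2 where "p2 i = max (p i) b" for i
  have "(\<Sum>i<n. \<bar>g (p1 (Suc i)) - g (p1 i)\<bar>) \<in> variation_sums a b g"
  proof (rule variation_sumsI)
    show "mono_on {..n} p1"
      unfolding p1_def by (intro monotone_onI min.mono monotone_onD[OF p(1)] order_refl)
  qed (use p(2) assms in \<open>auto simp: p1_def min_le_iff_disj\<close>)
  moreover have "(\<Sum>i<n. \<bar>g (p2 (Suc i)) - g (p2 i)\<bar>) \<in> variation_sums b c g"
  proof (rule variation_sumsI)
    show "mono_on {..n} p2"
      unfolding p2_def by (intro monotone_onI max.mono monotone_onD[OF p(1)] order_refl)
  qed (use p(2) assms in \<open>auto simp: p2_def le_max_iff_disj\<close>)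
  moreover have "S \<le> (\<Sum>i<n. \<bar>g (p1 (Suc i)) - g (p1 i)\<bar>) + (\<Sum>i<n. \<bar>g (p2 (Suc i)) - g (p2 i)\<bar>)"
    unfolding S sum.distrib[symmetric]
  proof (rule sum_mono)
    fix i assume "i \<in> {..<n}"
    then have le: "p i \<le> p (Suc i)" using p(1) by (auto simp: monotone_on_def)
    consider "p (Suc i) \<le> b" | "b \<le> p i" | "p i \<le> b" "b \<le> p (Suc i)" by linarith
    then show "\<bar>g (p (Suc i)) - g (p i)\<bar> \<le>
      \<bar>g (p1 (Suc i)) - g (p1 i)\<bar> + \<bar>g (p2 (Suc i)) - g (p2 i)\<bar>"
    proof cases
      case 3
      then have "p1 i = p i" "p1 (Suc i) = b" "p2 i = b" "p2 (Suc i) = p (Suc i)"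
        by (auto simp: p1_def p2_def)
      then show ?thesis
        using abs_triangle_ineq[of "g b - g (p i)" "g (p (Suc i)) - g b"] by simp
    qed (use le in \<open>simp_all add: p1_def p2_def min_def max_def\<close>)
  qed
  ultimately show ?thesis using that by blast
qed

text \<open>
  Putting the partitions one after the other creates one further increment, between the last point
  of the first and the first point of the second, which only makes the sum larger.
\<close>

lemma variation_sums_concat:
  assumes "S1 \<in> variation_sums a b g" "S2 \<in> variation_sums b c g" and "a \<le> b" "b \<le> c"
  obtains S where "S \<in> variation_sums a c g" "S1 + S2 \<le> S"
proof -
  obtain n p where p: "mono_on {..n} p" "\<And>i. i \<le> n \<Longrightarrow> a \<le> p i \<and> p i \<le> b"
    and S1: "S1 = (\<Sum>i<n. \<bar>g (p (Suc i)) - g (p i)\<bar>)"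
    using variation_sumsE[OF assms(1)] by blast
  obtain m q where q: "mono_on {..m} q" "\<And>i. i \<le> m \<Longrightarrow> b \<le> q i \<and> q i \<le> c"
    and S2: "S2 = (\<Sum>i<m. \<bar>g (q (Suc i)) - g (q i)\<bar>)"
    using variation_sumsE[OF assms(2)] by blast
  define r where "r i = (if i \<le> n then p i else q (i - Suc n))" for i
  let ?S = "\<Sum>i<Suc n + m. \<bar>g (r (Suc i)) - g (r i)\<bar>"
  have "mono_on {..Suc n + m} r"
  proof (rule monotone_onI)
    fix i j assume ij: "i \<in> {..Suc n + m}" "j \<in> {..Suc n + m}" "i \<le> j"
    show "r i \<le> r j"
    proof (cases "i \<le> n")
      case False
      then show ?thesis using ij monotone_onD[OF q(1), of "i - Suc n" "j - Suc n"] by (auto simp: r_def)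
    next
      case True
      show ?thesis
      proof (cases "j \<le> n")
        case True
        then show ?thesis using \<open>i \<le> n\<close> ij monotone_onD[OF p(1), of i j] by (auto simp: r_def)
      next
        case False
        then show ?thesis
          using \<open>i \<le> n\<close> ij p(2)[of i] q(2)[of "j - Suc n"] by (fastforce simp: r_def)
      qed
    qed
  qed
  moreover have "r ` {..Suc n + m} \<subseteq> {a..c}"
  proof (rule image_subsetI)
    fix i assume "i \<in> {..Suc n + m}"
    then show "r i \<in> {a..c}"
      using p(2)[of i] q(2)[of "i - Suc n"] assms(3,4) by (fastforce simp: r_def)
  qed
  ultimately have "?S \<in> variation_sums a c g" by (rule variation_sumsI)
  moreover have "S1 + S2 \<le> ?S"
  proof -
    have split: "sum h {..<k + m} = sum h {..<k} + (\<Sum>i<m. h (k + i))" for h :: "nat \<Rightarrow> real" and k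
      by (induction m) simp_all
    have "S1 = (\<Sum>i<n. \<bar>g (r (Suc i)) - g (r i)\<bar>)"
      unfolding S1 by (intro sum.cong) (auto simp: r_def)
    then have "S1 \<le> (\<Sum>i<Suc n. \<bar>g (r (Suc i)) - g (r i)\<bar>)"
      by simp
    moreover have "S2 = (\<Sum>i<m. \<bar>g (r (Suc (Suc n + i))) - g (r (Suc n + i))\<bar>)"
      unfolding S2 by (intro sum.cong) (auto simp: r_def)
    ultimately show ?thesis unfolding split by linarith
  qed
  ultimately show ?thesis using that by blast
qed

lemma finite_variation_subinterval:
  assumes "finite_variation_on a b g" "a \<le> a'" "b' \<le> b"
  shows "finite_variation_on a' b' g"
  using assms(1) unfolding finite_variation_on_def
  by (rule bdd_above_mono) (rule variation_sums_mono[OF assms(2,3)])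

lemma finite_variation_combine:
  assumes "finite_variation_on a b g" "finite_variation_on b c g" "a \<le> b" "b \<le> c"
  shows "finite_variation_on a c g"
proof -
  obtain B C where B: "\<And>S. S \<in> variation_sums a b g \<Longrightarrow> S \<le> B"
    and C: "\<And>S. S \<in> variation_sums b c g \<Longrightarrow> S \<le> C"
    using assms(1,2) unfolding finite_variation_on_def bdd_above_def by blast
  have "S \<le> B + C" if S: "S \<in> variation_sums a c g" for S
  proof -
    obtain S1 S2 where "S1 \<in> variation_sums a b g" "S2 \<in> variation_sums b c g" "S \<le> S1 + S2"
      using variation_sums_split[OF S assms(3,4)] by blast
    then show ?thesis using B[of S1] C[of S2] by linarith
  qed
  then show ?thesis unfolding finite_variation_on_def bdd_above_def by blast
qed

lemma finite_variation_add:
  assumes "finite_variation_on a b g" "finite_variation_on a b k"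
  shows "finite_variation_on a b (\<lambda>x. g x + k x)"
proof -
  obtain B C where B: "\<And>S. S \<in> variation_sums a b g \<Longrightarrow> S \<le> B"
    and C: "\<And>S. S \<in> variation_sums a b k \<Longrightarrow> S \<le> C"
    using assms unfolding finite_variation_on_def bdd_above_def by blast
  have "S \<le> B + C" if S: "S \<in> variation_sums a b (\<lambda>x. g x + k x)" for S
  proof -
    obtain n p where p: "mono_on {..n} p" "\<And>i. i \<le> n \<Longrightarrow> a \<le> p i \<and> p i \<le> b"
      and S: "S = (\<Sum>i<n. \<bar>g (p (Suc i)) + k (p (Suc i)) - (g (p i) + k (p i))\<bar>)"
      using variation_sumsE[OF S] by blast
    have range: "p ` {..n} \<subseteq> {a..b}" using p(2) by auto
    have "S \<le> (\<Sum>i<n. \<bar>g (p (Suc i)) - g (p i)\<bar> + \<bar>k (p (Suc i)) - k (p i)\<bar>)"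
      unfolding S by (intro sum_mono) linarith
    also have "\<dots> \<le> B + C"
      unfolding sum.distrib by (intro add_mono B C variation_sumsI p(1) range)
    finally show ?thesis .
  qed
  then show ?thesis unfolding finite_variation_on_def bdd_above_def by blast
qed

lemma total_variation_upper:
  assumes "finite_variation_on a b g" "S \<in> variation_sums a b g"
  shows "S \<le> total_variation a b g"
  using assms unfolding total_variation_def finite_variation_on_def by (intro cSup_upper)

lemma total_variation_least:
  assumes "a \<le> b" "\<And>S. S \<in> variation_sums a b g \<Longrightarrow> S \<le> B"
  shows "total_variation a b g \<le> B"
  unfolding total_variation_def using variation_sums_increment[OF assms(1)] assms(2)
  by (intro cSup_least) auto

lemma total_variation_combine:
  assumes fv: "finite_variation_on a c g" and "a \<le> b" "b \<le> c"
  shows "total_variation a c g = total_variation a b g + total_variation b c g"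
proof (rule antisym)
  have fv': "finite_variation_on a b g" "finite_variation_on b c g"
    using finite_variation_subinterval[OF fv] assms by auto
  show "total_variation a c g \<le> total_variation a b g + total_variation b c g"
  proof (rule total_variation_least)
    fix S assume S: "S \<in> variation_sums a c g"
    obtain S1 S2 where "S1 \<in> variation_sums a b g" "S2 \<in> variation_sums b c g" "S \<le> S1 + S2"
      using variation_sums_split[OF S assms(2,3)] by blast
    then show "S \<le> total_variation a b g + total_variation b c g"
      using total_variation_upper[OF fv'(1), of S1] total_variation_upper[OF fv'(2), of S2] by linarith
  qed (use assms in simp)
  have "S1 \<le> total_variation a c g - total_variation b c g" if S1: "S1 \<in> variation_sums a b g" for S1
  proof -
    have "total_variation b c g \<le> total_variation a c g - S1"
    proof (rule total_variation_least[OF \<open>b \<le> c\<close>])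
      fix S2 assume S2: "S2 \<in> variation_sums b c g"
      obtain S where "S \<in> variation_sums a c g" "S1 + S2 \<le> S"
        using variation_sums_concat[OF S1 S2 assms(2,3)] by blast
      then show "S2 \<le> total_variation a c g - S1"
        using total_variation_upper[OF fv, of S] by linarith
    qed
    then show ?thesis by linarith
  qed
  then show "total_variation a b g + total_variation b c g \<le> total_variation a c g"
    using total_variation_least[OF \<open>a \<le> b\<close>, of g] by force
qed

lemma variation_sum_monotone_le:
  assumes g: "mono_on {a..b} g" and S: "S \<in> variation_sums a b g"
  shows "S \<le> g b - g a"
proof -
  obtain n p where p: "mono_on {..n} p" "\<And>i. i \<le> n \<Longrightarrow> a \<le> p i \<and> p i \<le> b"
    and S: "S = (\<Sum>i<n. \<bar>g (p (Suc i)) - g (p i)\<bar>)"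
    using variation_sumsE[OF S] by blast
  have le: "p i \<le> p (Suc i)" if "i < n" for i
    using that p(1) by (auto simp: monotone_on_def)
  have gle: "g x \<le> g y" if "a \<le> x" "x \<le> y" "y \<le> b" for x y
    using monotone_onD[OF g, of x y] that by auto
  have "S = (\<Sum>i<n. g (p (Suc i)) - g (p i))"
    unfolding S using le p(2) by (intro sum.cong refl abs_of_nonneg) (simp add: gle)
  also have "\<dots> = g (p n) - g (p 0)" by (rule sum_lessThan_telescope)
  also have "\<dots> \<le> g b - g a"
    using gle[of a "p 0"] gle[of "p n" b] p(2)[of 0] p(2)[of n] by force
  finally show ?thesis .
qed

lemma finite_variation_monotone:
  assumes "mono_on {a..b} g"
  shows "finite_variation_on a b g"
  using variation_sum_monotone_le[OF assms] unfolding finite_variation_on_def bdd_above_def by blast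

lemma finite_variation_uminus:
  assumes "finite_variation_on a b (\<lambda>x. - g x)"
  shows "finite_variation_on a b g"
proof -
  have "variation_sums a b (\<lambda>x. - g x) = variation_sums a b g"
    unfolding variation_sums_def by (simp add: abs_minus_commute)
  then show ?thesis using assms by (simp add: finite_variation_on_def)
qed

lemma total_variation_monotone:
  assumes "a \<le> b" "mono_on {a..b} g"
  shows "total_variation a b g = g b - g a"
proof (rule antisym)
  show "total_variation a b g \<le> g b - g a"
    using assms variation_sum_monotone_le by (intro total_variation_least)
  have "\<bar>g b - g a\<bar> \<le> total_variation a b g"
    using assms by (intro total_variation_upper finite_variation_monotone variation_sums_increment)
  then show "g b - g a \<le> total_variation a b g" by linarith
qed

text \<open>
  This reduces the right continuity of the variation function, and the mass that it gives to
  intervals on which the path increases, to properties of the path itself.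
\<close>

lemma total_variation_monotone_extend:
  assumes "finite_variation_on a T w" "a \<le> x" "x \<le> y" "y \<le> T" "mono_on {x..y} w"
  shows "total_variation a y w = total_variation a x w + (w y - w x)"
  using total_variation_combine[OF finite_variation_subinterval[OF assms(1)], of a y x]
    total_variation_monotone assms by simp

lemma total_variation_increment_ge:
  assumes fv: "finite_variation_on a T w" and "a \<le> x" "x \<le> y" "y \<le> T"
  shows "\<bar>w y - w x\<bar> \<le> total_variation a y w - total_variation a x w"
proof -
  have "total_variation a y w = total_variation a x w + total_variation x y w"
    using assms by (intro total_variation_combine finite_variation_subinterval[OF fv]) auto
  moreover have "\<bar>w y - w x\<bar> \<le> total_variation x y w"
    using assms by (intro total_variation_upper finite_variation_subinterval[OF fv] variation_sums_increment) auto
  ultimately show ?thesis by simp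
qed

text \<open>
  Close to a time \<open>x\<close>, a step path is constant from \<open>x\<close> on. Up to and including \<open>x\<close> it is constant
  except for one final jump, hence monotone in one of the two directions.
\<close>

lemma step_path_finite_variation:
  assumes u: "step_path F u" and "0 \<le> T"
  shows "finite_variation_on 0 T u"
  using \<open>0 \<le> T\<close>
proof (induction rule: Bolzano)
  case (trans a b c)
  then show ?case by (rule finite_variation_combine)
next
  case (local x)
  show ?case
    using step_path_left[OF u, of x] step_path_right[OF u, of x]
  proof (elim exE conjE)
    fix d c d' :: real
    assume d: "d > 0" and dc: "\<forall>y\<in>{x - d..<x}. u y = c"
      and d': "d' > 0" and dr: "\<forall>y\<in>{x..x + d'}. u y = u x"
    have "finite_variation_on a b u" if ab: "a \<le> x \<and> x \<le> b \<and> b - a < min d d'" for a b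
    proof (rule finite_variation_combine)
      have "u y = c" if "y \<in> {a..<x}" for y
        by (rule bspec[OF dc]) (use that ab in auto)
      then have *: "u y = (if y < x then c else u x)" if "y \<in> {a..x}" for y
        using that by (cases "y = x") simp_all
      show "finite_variation_on a x u"
      proof (cases "c \<le> u x")
        case True
        have "mono_on {a..x} u"
        proof (rule monotone_onI)
          fix r s assume "r \<in> {a..x}" "s \<in> {a..x}" "r \<le> s"
          then show "u r \<le> u s" using *[of r] *[of s] True by (auto split: if_splits)
        qed
        then show ?thesis by (rule finite_variation_monotone)
      next
        case False
        have "mono_on {a..x} (\<lambda>y. - u y)"
        proof (rule monotone_onI)
          fix r s assume "r \<in> {a..x}" "s \<in> {a..x}" "r \<le> s"
          then show "- u r \<le> - u s" using *[of r] *[of s] False by (auto split: if_splits)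
        qed
        then show ?thesis by (rule finite_variation_uminus[OF finite_variation_monotone])
      qed
      have *: "u y = u x" if "y \<in> {x..b}" for y
        by (rule bspec[OF dr]) (use that ab in auto)
      have "mono_on {x..b} u"
      proof (rule monotone_onI)
        fix r s assume "r \<in> {x..b}" "s \<in> {x..b}"
        then show "u r \<le> u s" using *[of r] *[of s] by linarith
      qed
      then show "finite_variation_on x b u" by (rule finite_variation_monotone)
    qed (use ab in auto)
    then show ?thesis using d d' by (intro exI[of _ "min d d'"] conjI allI impI) simp_all
  qed
qed

section \<open>Lebesgue--Stieltjes integrals along tame paths\<close>

text \<open>
  Measurability is required only after cutting \<open>g\<close> off outside \<open>D\<close>: functionals along paths are
  not controlled outside \<open>[0,T]\<close>.
\<close>

lemma set_integrable_bounded: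
  fixes g :: "real \<Rightarrow> real"
  assumes [measurable_cong]: "sets M = sets borel" and A: "A \<in> sets borel" "A \<subseteq> D"
    and g: "(\<lambda>x. indicator D x * g x) \<in> borel_measurable borel"
    and B: "\<And>x. x \<in> A \<Longrightarrow> \<bar>g x\<bar> \<le> B" and fin: "emeasure M A < \<infinity>"
  shows "set_integrable M A g"
proof -
  have "integrable M (\<lambda>x. indicator A x *\<^sub>R (indicator D x * g x))"
  proof (rule integrableI_bounded_set_indicator)
    show "A \<in> sets M" using A assms(1) by simp
    show "(\<lambda>x. indicator D x * g x) \<in> borel_measurable M"
      using g measurable_cong_sets[OF assms(1) refl] by blast
    show "AE x in M. x \<in> A \<longrightarrow> norm (indicator D x * g x) \<le> B"
      using B A(2) by (intro AE_I2) (auto simp: indicator_def)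
  qed (rule fin)
  moreover have "(\<lambda>x. indicator A x *\<^sub>R (indicator D x * g x)) = (\<lambda>x. indicator A x *\<^sub>R g x)"
    using A(2) by (auto simp: indicator_def fun_eq_iff)
  ultimately show ?thesis by (simp add: set_integrable_def)
qed

lemma set_integral_near_constant:
  fixes g :: "'a \<Rightarrow> real"
  assumes g: "set_integrable M A g" and A: "A \<in> sets M" "emeasure M A < \<infinity>"
    and near: "\<And>x. x \<in> A \<Longrightarrow> \<bar>g x - k\<bar> \<le> e"
  shows "\<bar>(LINT x:A|M. g x) - k * measure M A\<bar> \<le> e * measure M A"
proof -
  have c: "set_integrable M A (\<lambda>_. c)" "(LINT x:A|M. c) = c * measure M A" for c :: real
    using A by (simp_all add: set_integrable_def set_lebesgue_integral_def)
  have "(LINT x:A|M. k - e) \<le> (LINT x:A|M. g x)"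
    using near by (intro set_integral_mono c g) (force simp: abs_le_iff)
  moreover have "(LINT x:A|M. g x) \<le> (LINT x:A|M. k + e)"
    using near by (intro set_integral_mono c g) (force simp: abs_le_iff)
  ultimately show ?thesis by (simp add: c algebra_simps abs_le_iff)
qed

text \<open>
  The definition of the integral over \<open>(0,t]\<close> uses a measure that depends on \<open>t\<close>. Integrals up to
  different times are compared by this localisation: a Stieltjes measure on \<open>(a,b]\<close> depends only on
  the values of its distribution function on \<open>[a,b]\<close>. The two measures restricted to \<open>(a,b]\<close> agree on
  all half lines, hence everywhere.
\<close>

lemma set_integral_interval_measure_cong:
  fixes g :: "real \<Rightarrow> real"
  assumes F: "\<And>x y. x \<le> y \<Longrightarrow> F x \<le> F y" "\<And>x. continuous (at_right x) F"
    and G: "\<And>x y. x \<le> y \<Longrightarrow> G x \<le> G y" "\<And>x. continuous (at_right x) G"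
    and eq: "\<And>x. a \<le> x \<Longrightarrow> x \<le> b \<Longrightarrow> F x = G x"
  shows "(LINT x:{a<..b}|interval_measure F. g x) = (LINT x:{a<..b}|interval_measure G. g x)"
proof -
  let ?D = "\<lambda>H. density (interval_measure H) (indicator {a<..b})"
  have dens: "emeasure (?D H) A = emeasure (interval_measure H) ({a<..b} \<inter> A)"
    if "A \<in> sets borel" for H A
    using that by (subst emeasure_density) (simp_all add: nn_integral_set_ennreal indicator_inter_arith[symmetric] flip: nn_integral_indicator)
  have tail: "{a<..b} \<inter> {x<..} = {max a x<..b}" for x :: real by auto
  have "?D F = ?D G"
  proof (rule measure_eqI_lessThan)
    fix x
    have "emeasure (?D F) {x<..} = emeasure (interval_measure F) {max a x<..b}"
      by (simp add: dens tail)
    also have "\<dots> = (if max a x \<le> b then F b - F (max a x) else 0)"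
      by (rule emeasure_interval_measure_Ioc_eq[OF F])
    also have "\<dots> = (if max a x \<le> b then G b - G (max a x) else 0)"
      using eq[of b] eq[of "max a x"] by auto
    also have "\<dots> = emeasure (interval_measure G) {max a x<..b}"
      by (rule emeasure_interval_measure_Ioc_eq[OF G, symmetric])
    finally show "emeasure (?D F) {x<..} = emeasure (?D G) {x<..}"
      by (simp add: dens tail)
    show "emeasure (?D F) {x<..} < \<infinity>"
      by (simp add: dens tail emeasure_interval_measure_Ioc_eq[OF F])
  qed simp_all
  then have "emeasure (interval_measure F) A = emeasure (interval_measure G) A"
    if "A \<in> sets borel" "A \<subseteq> {a<..b}" for A
    using dens[OF that(1), of F] dens[OF that(1), of G] that(2) by (simp add: Int_absorb1)
  then have "restrict_space (interval_measure F) {a<..b} = restrict_space (interval_measure G) {a<..b}"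
    by (intro measure_eqI) (auto simp: sets_restrict_space emeasure_restrict_space)
  then show ?thesis
    unfolding set_lebesgue_integral_def
    using integral_restrict_space[of "{a<..b}" "interval_measure F" g]
      integral_restrict_space[of "{a<..b}" "interval_measure G" g] by simp
qed

lemma clamp_mono:
  assumes "mono_on {0..s} P" "0 \<le> s" "x \<le> y"
  shows "P (max 0 (min x s)) \<le> P (max 0 (min y s :: real))"
  by (rule monotone_onD[OF assms(1)]) (use assms in auto)

lemma clamp_right_continuous:
  fixes P :: "real \<Rightarrow> real"
  assumes "\<And>x. 0 \<le> x \<Longrightarrow> x < s \<Longrightarrow> (P \<longlongrightarrow> P x) (at_right x)" "0 \<le> s"
  shows "continuous (at_right a) (\<lambda>x. P (max 0 (min x s)))"
proof -
  let ?Q = "\<lambda>x. P (max 0 (min x s))"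
  consider "a < 0" | "s \<le> a" | "0 \<le> a" "a < s" by linarith
  then have "(?Q \<longlongrightarrow> ?Q a) (at_right a)"
  proof cases
    case 1
    then have "\<forall>\<^sub>F x in at_right a. x \<in> {a<..<0}"
      by (intro eventually_at_right_real)
    then have "\<forall>\<^sub>F x in at_right a. ?Q a = ?Q x"
      by eventually_elim (use 1 \<open>0 \<le> s\<close> in auto)
    then show ?thesis by (rule Lim_transform_eventually[OF tendsto_const])
  next
    case 2
    then have "\<forall>\<^sub>F x in at_right a. ?Q a = ?Q x"
      by (auto simp: eventually_at_filter)
    then show ?thesis by (rule Lim_transform_eventually[OF tendsto_const])
  next
    case 3
    then have "\<forall>\<^sub>F x in at_right a. x \<in> {a<..<s}"
      by (intro eventually_at_right_real)
    then have "\<forall>\<^sub>F x in at_right a. P x = ?Q x"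
      by eventually_elim (use 3 in auto)
    then show ?thesis
      using Lim_transform_eventually[OF assms(1)[OF 3]] 3 by simp
  qed
  then show ?thesis by (simp add: continuous_within)
qed

text \<open>
  The paths on which the change of variable formula is evaluated. Break points \<open>F\<close> are the only times
  at which the path may jump; the last condition makes the right continuity of the variation function
  elementary, since to the right of each time the variation grows like the path itself. Step paths
  satisfy all of this, and so do their sums with continuous nondecreasing functions.
\<close>

definition tame_path :: "real \<Rightarrow> real set \<Rightarrow> path \<Rightarrow> bool" where
  "tame_path T F v \<longleftrightarrow> v \<in> fv_paths T \<and> finite F \<and>
     (\<forall>s\<in>{0<..T} - F. (v \<longlongrightarrow> v s) (at_left s)) \<and>
     (\<forall>x\<in>{0..<T}. \<exists>d>0. mono_on {x..x + d} v)"

text \<open>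
  For \<open>\<sigma> = 1\<close> and \<open>\<sigma> = -1\<close> these are the two parts of the Jordan decomposition, so that they can be
  treated together.
\<close>

definition jordan_part :: "real \<Rightarrow> path \<Rightarrow> real \<Rightarrow> real" where
  "jordan_part \<sigma> v x = (total_variation 0 x v + \<sigma> * v x) / 2"

lemma pos_part_eq_jordan_part: "pos_part s v = (\<lambda>x. jordan_part 1 v (max 0 (min x s)))"
  by (auto simp: pos_part_def jordan_part_def Let_def)

lemma neg_part_eq_jordan_part: "neg_part s v = (\<lambda>x. jordan_part (-1) v (max 0 (min x s)))"
  by (auto simp: neg_part_def jordan_part_def Let_def)

lemma jordan_part_mono:
  assumes "finite_variation_on 0 T v" "\<bar>\<sigma>\<bar> = 1"
  shows "mono_on {0..T} (jordan_part \<sigma> v)"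
proof (rule monotone_onI)
  fix x y assume "x \<in> {0..T}" "y \<in> {0..T}" "x \<le> y"
  then have "\<bar>v y - v x\<bar> \<le> total_variation 0 y v - total_variation 0 x v"
    using total_variation_increment_ge[OF assms(1)] by simp
  moreover have "\<sigma> = 1 \<or> \<sigma> = -1" using assms(2) by linarith
  ultimately show "jordan_part \<sigma> v x \<le> jordan_part \<sigma> v y"
    by (auto simp: jordan_part_def)
qed

text \<open>
  While the path increases, the positive part takes over the whole increment (factor \<open>1\<close>) and the
  negative part stays constant (factor \<open>0\<close>).
\<close>

lemma jordan_part_monotone_extend:
  assumes "finite_variation_on 0 T v" "0 \<le> x" "x \<le> y" "y \<le> T" "mono_on {x..y} v"
  shows "jordan_part \<sigma> v y = jordan_part \<sigma> v x + (1 + \<sigma>) / 2 * (v y - v x)"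
  using total_variation_monotone_extend[OF assms] by (simp add: jordan_part_def field_simps)

lemma jordan_part_right_continuous:
  assumes v: "tame_path T F v" and x: "0 \<le> x" "x < T"
  shows "(jordan_part \<sigma> v \<longlongrightarrow> jordan_part \<sigma> v x) (at_right x)"
proof -
  have fv: "finite_variation_on 0 T v" and rcll: "v \<in> rcll_paths T"
    using v by (auto simp: tame_path_def fv_paths_def)
  have "x \<in> {0..<T}" using x by simp
  then obtain d where d: "d > 0" "mono_on {x..x + d} v"
    using v unfolding tame_path_def by blast
  have "\<forall>\<^sub>F y in at_right x. y \<in> {x<..<min T (x + d)}"
    using x d(1) by (intro eventually_at_right_real) simp
  then have "\<forall>\<^sub>F y in at_right x. jordan_part \<sigma> v x + (1 + \<sigma>) / 2 * (v y - v x) = jordan_part \<sigma> v y"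
  proof eventually_elim
    case (elim y)
    then have "mono_on {x..y} v" by (intro mono_on_subset[OF d(2)]) auto
    then show ?case using elim x by (intro jordan_part_monotone_extend[OF fv, symmetric]) auto
  qed
  moreover have "((\<lambda>y. jordan_part \<sigma> v x + (1 + \<sigma>) / 2 * (v y - v x)) \<longlongrightarrow>
      jordan_part \<sigma> v x + (1 + \<sigma>) / 2 * (v x - v x)) (at_right x)"
    by (intro tendsto_intros rcll_path_right[OF rcll x])
  ultimately show ?thesis
    using Lim_transform_eventually by fastforce
qed

lemma jordan_part_clamped:
  assumes v: "tame_path T F v" and "0 \<le> s" "s \<le> T" "\<bar>\<sigma>\<bar> = 1"
  defines "J \<equiv> \<lambda>x. jordan_part \<sigma> v (max 0 (min x s))"
  shows "x \<le> y \<Longrightarrow> J x \<le> J y" and "continuous (at_right x) J"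
proof -
  have "finite_variation_on 0 T v"
    using v by (auto simp: tame_path_def fv_paths_def)
  then have "mono_on {0..s} (jordan_part \<sigma> v)"
    by (rule mono_on_subset[OF jordan_part_mono[OF _ assms(4)]]) (use assms(3) in auto)
  then show "x \<le> y \<Longrightarrow> J x \<le> J y"
    unfolding J_def using clamp_mono assms(2) by blast
  show "continuous (at_right x) J"
    unfolding J_def using assms(2,3) jordan_part_right_continuous[OF v]
    by (intro clamp_right_continuous) auto
qed

text \<open>
  Over \<open>(0,t]\<close> the integrals up to \<open>s\<close> and up to \<open>t\<close> coincide by localisation. The rest is an
  integral over \<open>(t,s]\<close> of a function close to \<open>k\<close> against a measure of mass \<open>m\<close>.
\<close>

lemma jordan_part_integral_split:
  fixes g :: "real \<Rightarrow> real"
  assumes v: "tame_path T F v" and t: "0 \<le> t" "t \<le> s" "s \<le> T" and \<sigma>: "\<bar>\<sigma>\<bar> = 1"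
    and g: "(\<lambda>x. indicator {0<..T} x * g x) \<in> borel_measurable borel"
      "\<And>x. x \<in> {0<..T} \<Longrightarrow> \<bar>g x\<bar> \<le> B"
    and mono: "mono_on {t..s} v"
    and near: "\<And>x. x \<in> {t<..s} \<Longrightarrow> \<bar>g x - k\<bar> \<le> e"
  defines "M \<equiv> \<lambda>r. interval_measure (\<lambda>x. jordan_part \<sigma> v (max 0 (min x r)))"
    and "m \<equiv> (1 + \<sigma>) / 2 * (v s - v t)"
  shows "\<bar>(LINT x:{0<..s}|M s. g x) - (LINT x:{0<..t}|M t. g x) - k * m\<bar> \<le> e * m"
proof -
  have "0 \<le> s" "t \<le> T" using t by auto
  note J = jordan_part_clamped[OF v \<open>0 \<le> s\<close> \<open>s \<le> T\<close> \<sigma>]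
  note J' = jordan_part_clamped[OF v \<open>0 \<le> t\<close> \<open>t \<le> T\<close> \<sigma>]
  have fin: "emeasure (M s) {a<..b} < \<infinity>" for a b
    unfolding M_def by (simp add: emeasure_interval_measure_Ioc_eq[OF J])
  have int: "set_integrable (M s) {a<..b} g" if "0 \<le> a" "b \<le> s" for a b
    by (rule set_integrable_bounded[OF _ _ _ g(1), where B = B]) (use that t fin g(2) in \<open>auto simp: M_def\<close>)
  have "{0<..s} = {0<..t} \<union> {t<..s}" using t by auto
  then have "(LINT x:{0<..s}|M s. g x) = (LINT x:{0<..t}|M s. g x) + (LINT x:{t<..s}|M s. g x)"
    using t int by (simp add: set_integral_Un)
  moreover have "(LINT x:{0<..t}|M s. g x) = (LINT x:{0<..t}|M t. g x)"
    unfolding M_def by (rule set_integral_interval_measure_cong[OF J J']) (use t in auto)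
  moreover have "measure (M s) {t<..s} = m"
  proof -
    have fv: "finite_variation_on 0 T v"
      using v by (auto simp: tame_path_def fv_paths_def)
    have "m \<ge> 0"
      using \<sigma> monotone_onD[OF mono, of t s] t by (auto simp: m_def)
    moreover have "emeasure (M s) {t<..s} = ennreal m"
      unfolding M_def m_def
      using t jordan_part_monotone_extend[OF fv t mono, of \<sigma>]
      by (simp add: emeasure_interval_measure_Ioc_eq[OF J])
    ultimately show ?thesis by (simp add: measure_def)
  qed
  moreover have "\<bar>(LINT x:{t<..s}|M s. g x) - k * measure (M s) {t<..s}\<bar> \<le> e * measure (M s) {t<..s}"
    using t int fin near by (intro set_integral_near_constant) (auto simp: M_def)
  ultimately show ?thesis by simp
qed

lemma stieltjes_integral_increment:
  fixes g :: "real \<Rightarrow> real"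
  assumes v: "tame_path T F v" and t: "0 \<le> t" "t \<le> s" "s \<le> T"
    and g: "(\<lambda>x. indicator {0<..T} x * g x) \<in> borel_measurable borel"
      "\<And>x. x \<in> {0<..T} \<Longrightarrow> \<bar>g x\<bar> \<le> B"
    and mono: "mono_on {t..s} v"
    and near: "\<And>x. x \<in> {t<..s} \<Longrightarrow> \<bar>g x - k\<bar> \<le> e"
  shows "\<bar>stieltjes_integral s g v - stieltjes_integral t g v - k * (v s - v t)\<bar> \<le> e * (v s - v t)"
  using jordan_part_integral_split[OF v t _ g mono near, of 1]
    jordan_part_integral_split[OF v t _ g mono near, of "-1"]
  by (simp add: stieltjes_integral_def pos_part_eq_jordan_part neg_part_eq_jordan_part)

section \<open>The increment of the functional along a tame path\<close>

text \<open>
  Along a tame path, a continuous functional is continuous except at finitely many times, where it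
  still has one-sided limits. This gives all the measurability and boundedness that the integrals
  need, for the functional as well as for its left limits.
\<close>

lemma functional_along_tame_path:
  assumes f: "continuous_functional T f" and v: "tame_path T F v" and "0 \<le> T"
  obtains B where
    "(\<lambda>x. indicator {0..T} x * f x v) \<in> borel_measurable borel"
    "\<And>x. x \<in> {0..T} \<Longrightarrow> \<bar>f x v\<bar> \<le> B"
    "(\<lambda>x. indicator {0<..T} x * left_lim (\<lambda>u. f u v) x) \<in> borel_measurable borel"
    "\<And>x. x \<in> {0<..T} \<Longrightarrow> \<bar>left_lim (\<lambda>u. f u v) x\<bar> \<le> B"
    "\<And>x. x \<in> {0<..T} - F \<Longrightarrow> left_lim (\<lambda>u. f u v) x = f x v"
proof -
  define \<phi> where "\<phi> = (\<lambda>u. f u v)"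
  have rcll: "v \<in> rcll_paths T" and "finite F"
    and left: "\<And>s. s \<in> {0<..T} - F \<Longrightarrow> (v \<longlongrightarrow> v s) (at_left s)"
    using v by (auto simp: tame_path_def fv_paths_def)
  have \<phi>: "\<phi> \<in> rcll_paths T"
    unfolding \<phi>_def by (rule functional_along_path_rcll[OF f rcll])
  obtain B where B: "\<And>s. 0 \<le> s \<Longrightarrow> s \<le> T \<Longrightarrow> \<bar>\<phi> s\<bar> \<le> B"
    using rcll_path_bounded[OF \<phi> \<open>0 \<le> T\<close>] by blast
  have left_lim: "left_lim \<phi> s = l" if "(\<phi> \<longlongrightarrow> l) (at_left s)" "0 < s" for s l
    using that by (simp add: left_lim_def tendsto_Lim)
  have \<phi>_left: "(\<phi> \<longlongrightarrow> \<phi> s) (at_left s)" if "s \<in> {0<..T} - F" for s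
    unfolding \<phi>_def
    using that left[OF that] by (intro functional_along_path_left_continuous[OF f rcll]) auto
  have eq: "left_lim \<phi> s = \<phi> s" if "s \<in> {0<..T} - F" for s
    using left_lim[OF \<phi>_left[OF that]] that by simp
  have meas: "(\<lambda>x. indicator {0..T} x * \<phi> x) \<in> borel_measurable borel"
  proof (rule borel_measurable_continuous_countable_exceptions)
    show "countable (F \<union> {0, T})" using \<open>finite F\<close> by (simp add: countable_finite)
    show "continuous_on (- (F \<union> {0, T})) (\<lambda>x. indicator {0..T} x * \<phi> x)"
    proof (intro continuous_at_imp_continuous_on ballI)
      fix x assume x: "x \<in> - (F \<union> {0, T})"
      show "isCont (\<lambda>x. indicator {0..T} x * \<phi> x) x"
      proof (cases "x \<in> {0<..<T}")
        case True
        have "(\<phi> \<longlongrightarrow> \<phi> x) (at_right x)"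
          using True by (intro rcll_path_right[OF \<phi>]) auto
        moreover have "(\<phi> \<longlongrightarrow> \<phi> x) (at_left x)"
          using True x by (intro \<phi>_left) auto
        ultimately have "isCont \<phi> x" 
          by (simp add: isCont_def filterlim_at_split)
        have ev: "\<forall>\<^sub>F y in nhds x. indicator {0..T} y * \<phi> y = \<phi> y"
          by (rule eventually_mono[OF eventually_nhds_in_open[of "{0<..<T}" x]])
             (use True in auto)
        show ?thesis using \<open>isCont \<phi> x\<close> unfolding isCont_cong[OF ev] .
      next
        case False
        then have "x \<in> - {0..T}" using x by auto
        then have ev: "\<forall>\<^sub>F y in nhds x. indicator {0..T} y * \<phi> y = 0"
          by (intro eventually_mono[OF eventually_nhds_in_open[of "- {0..T}" x]]) auto
        show ?thesis unfolding isCont_cong[OF ev] by simp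
      qed
    qed
  qed
  have "(\<lambda>x. indicator {0<..T} x * left_lim \<phi> x) \<in> borel_measurable borel"
    by (rule measurable_discrete_difference[OF meas, of "F \<union> {0}"])
       (use \<open>finite F\<close> eq in \<open>auto simp: countable_finite indicator_def\<close>)
  moreover have "\<bar>left_lim \<phi> s\<bar> \<le> B" if s: "s \<in> {0<..T}" for s
  proof -
    obtain l where l: "(\<phi> \<longlongrightarrow> l) (at_left s)"
      using rcll_path_left[OF \<phi>, of s] s by auto
    have "\<forall>\<^sub>F x in at_left s. x \<in> {0<..<s}"
      using s by (intro eventually_at_left_real) auto
    then have "\<forall>\<^sub>F x in at_left s. \<bar>\<phi> x\<bar> \<le> B"
      by eventually_elim (use B s in auto)
    then have "\<bar>l\<bar> \<le> B"
      by (intro tendsto_upperbound[OF tendsto_rabs[OF l]]) auto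
    then show ?thesis using left_lim[OF l] s by simp
  qed
  ultimately show ?thesis
    using that[of B] meas B eq unfolding \<phi>_def by auto
qed

text \<open>
  Where the path does not jump, neither does the functional.
\<close>

lemma jump_remainder_zero:
  assumes f: "continuous_functional T f" and v: "tame_path T F v" and s: "s \<in> {0<..T} - F"
  shows "jump_remainder f f1 v s = 0"
proof -
  have "0 \<le> T" using s by simp
  then have "left_lim (\<lambda>u. f u v) s = f s v"
    using functional_along_tame_path[OF f v] s by metis
  moreover have "(v \<longlongrightarrow> v s) (at_left s)"
    using v s by (auto simp: tame_path_def)
  then have "left_lim v s = v s"
    using s by (simp add: left_lim_def tendsto_Lim)
  ultimately show ?thesis by (simp add: jump_remainder_def jump_def)
qed

text \<open>
  Subtracting the change of variable formula at \<open>t\<close> from that at \<open>s\<close> leaves a time integral and a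
  Stieltjes integral over \<open>(t,s]\<close>. The jump sums cancel because the path has no jumps in \<open>(t,s]\<close>, and
  the Stieltjes integral is against a positive measure of mass \<open>v s - v t\<close> because the path increases
  there.
\<close>

lemma functional_increment_estimate:
  assumes f: "continuous_functional T f" "continuous_functional T f0" "continuous_functional T f1"
    and v: "tame_path T F v"
    and formula: "\<And>t. t \<in> {0..T} \<Longrightarrow>
       f t v = f 0 v + (LINT s:{0..t}|lborel. f0 s v)
         + stieltjes_integral t (left_lim (\<lambda>u. f1 u v)) v + jump_sum f f1 t v"
    and t: "0 \<le> t" "t \<le> s" "s \<le> T"
    and F: "F \<inter> {t<..s} = {}" and mono: "mono_on {t..s} v"
    and near0: "\<And>x. x \<in> {t<..s} \<Longrightarrow> \<bar>f0 x v - k0\<bar> \<le> e"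
    and near1: "\<And>x. x \<in> {t<..s} \<Longrightarrow> \<bar>f1 x v - k1\<bar> \<le> e"
  shows "\<bar>f s v - f t v - k0 * (s - t) - k1 * (v s - v t)\<bar> \<le> e * ((s - t) + (v s - v t))"
proof -
  have "0 \<le> T" using t by simp
  obtain B0 where B0: "(\<lambda>x. indicator {0..T} x * f0 x v) \<in> borel_measurable borel"
    "\<And>x. x \<in> {0..T} \<Longrightarrow> \<bar>f0 x v\<bar> \<le> B0"
    using functional_along_tame_path[OF f(2) v \<open>0 \<le> T\<close>] by metis
  obtain B1 where B1:
    "(\<lambda>x. indicator {0<..T} x * left_lim (\<lambda>u. f1 u v) x) \<in> borel_measurable borel"
    "\<And>x. x \<in> {0<..T} \<Longrightarrow> \<bar>left_lim (\<lambda>u. f1 u v) x\<bar> \<le> B1"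
    "\<And>x. x \<in> {0<..T} - F \<Longrightarrow> left_lim (\<lambda>u. f1 u v) x = f1 x v"
    using functional_along_tame_path[OF f(3) v \<open>0 \<le> T\<close>] by metis
  have int: "set_integrable lborel A (\<lambda>x. f0 x v)" if "A \<in> sets borel" "A \<subseteq> {0..T}" for A
  proof (rule set_integrable_bounded[OF _ that B0(1), where B = B0])
    have "emeasure lborel A \<le> emeasure lborel {0..T}"
      using that by (intro emeasure_mono) auto
    also have "\<dots> < \<infinity>" by (simp add: emeasure_lborel_Icc_eq)
    finally show "emeasure lborel A < \<infinity>" .
  qed (use that B0(2) in auto)
  have "{0..s} = {0..t} \<union> {t<..s}" using t by auto
  moreover have "(LINT x:{0..t} \<union> {t<..s}|lborel. f0 x v) =
      (LINT x:{0..t}|lborel. f0 x v) + (LINT x:{t<..s}|lborel. f0 x v)"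
    by (rule set_integral_Un) (use t in \<open>auto intro!: int\<close>)
  ultimately have split: "(LINT x:{0..s}|lborel. f0 x v) =
      (LINT x:{0..t}|lborel. f0 x v) + (LINT x:{t<..s}|lborel. f0 x v)"
    by simp
  have "set_integrable lborel {t<..s} (\<lambda>x. f0 x v)"
    by (rule int) (use t in auto)
  then have time: "\<bar>(LINT x:{t<..s}|lborel. f0 x v) - k0 * (s - t)\<bar> \<le> e * (s - t)"
    using set_integral_near_constant[of lborel "{t<..s}" "\<lambda>x. f0 x v" k0 e] near0 t
    by (auto simp: measure_def)
  have "\<bar>left_lim (\<lambda>u. f1 u v) x - k1\<bar> \<le> e" if "x \<in> {t<..s}" for x
  proof -
    have "x \<in> {0<..T} - F" using that t F by auto
    then show ?thesis using B1(3) near1[OF that] by simp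
  qed
  then have space: "\<bar>stieltjes_integral s (left_lim (\<lambda>u. f1 u v)) v
      - stieltjes_integral t (left_lim (\<lambda>u. f1 u v)) v - k1 * (v s - v t)\<bar> \<le> e * (v s - v t)"
    using stieltjes_integral_increment[OF v t B1(1,2) mono] by blast
  have "jump_remainder f f1 v x = 0" if "x \<in> {0..s} - {0..t}" for x
    using that t F by (intro jump_remainder_zero[OF f(1) v]) auto
  then have jumps: "jump_sum f f1 s v = jump_sum f f1 t v"
    unfolding jump_sum_def using t by (intro infsum_cong_neutral) auto
  have "f s v - f t v = (LINT x:{t<..s}|lborel. f0 x v)
      + (stieltjes_integral s (left_lim (\<lambda>u. f1 u v)) v
      - stieltjes_integral t (left_lim (\<lambda>u. f1 u v)) v)"
    using formula[of s] formula[of t] split jumps t by simp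
  moreover have "e * ((s - t) + (v s - v t)) = e * (s - t) + e * (v s - v t)"
    by (simp add: distrib_left)
  ultimately show ?thesis using time space by linarith
qed

section \<open>Difference quotients\<close>

lemma tame_step_plus_monotone:
  assumes u: "step_path F u" and \<rho>: "mono \<rho>" "\<And>x. isCont \<rho> x" and "0 \<le> T"
  shows "tame_path T F (\<lambda>s. u s + \<rho> s)"
  unfolding tame_path_def fv_paths_def mem_Collect_eq
proof (intro conjI ballI)
  show "(\<lambda>s. u s + \<rho> s) \<in> rcll_paths T"
    by (intro rcll_path_add step_path_rcll[OF u] rcll_path_continuous \<rho>(2))
  show "finite_variation_on 0 T (\<lambda>s. u s + \<rho> s)"
    using \<rho>(1) by (intro finite_variation_add step_path_finite_variation[OF u \<open>0 \<le> T\<close>]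
        finite_variation_monotone) (auto simp: monotone_on_def)
  show "finite F" using u by (simp add: step_path_def)
next
  fix s assume "s \<in> {0<..T} - F"
  then have "(u \<longlongrightarrow> u s) (at_left s)"
    using step_path_left_limit[OF u, of s] by auto
  moreover have "(\<rho> \<longlongrightarrow> \<rho> s) (at_left s)"
    using \<rho>(2)[of s] by (simp add: isCont_def filterlim_at_split)
  ultimately show "((\<lambda>s. u s + \<rho> s) \<longlongrightarrow> u s + \<rho> s) (at_left s)"
    by (rule tendsto_add)
next
  fix x
  show "\<exists>d>0. mono_on {x..x + d} (\<lambda>s. u s + \<rho> s)"
    using step_path_right[OF u, of x]
  proof (elim exE conjE)
    fix d :: real assume "d > 0" and d: "\<forall>y\<in>{x..x + d}. u y = u x"
    have "mono_on {x..x + d} (\<lambda>s. u s + \<rho> s)"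
    proof (rule monotone_onI)
      fix y z assume "y \<in> {x..x + d}" "z \<in> {x..x + d}" "y \<le> z"
      then show "u y + \<rho> y \<le> u z + \<rho> z"
        using bspec[OF d, of y] bspec[OF d, of z] monoD[OF \<rho>(1), of y z] by linarith
    qed
    with \<open>d > 0\<close> show ?thesis by blast
  qed
qed

text \<open>
  The increment estimate for arbitrary RCLL paths. The perturbation \<open>\<rho>\<close> is a ramp started at \<open>t\<close>, or
  zero, so that one statement serves both derivatives. The stopped path is replaced by nearby step
  paths, to which the change of variable formula applies. What makes this work is that \<open>\<delta>\<close> is found from
  the continuity of \<open>f0\<close> and \<open>f1\<close> at the single point \<open>(t,w)\<close> and hence does not depend on the
  step path. Only the two values of \<open>f\<close> vary with it, and they converge by
  continuity, so no limit under an integral is needed.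
\<close>

lemma rcll_path_increment_estimate:
  assumes "0 \<le> t" "t < T" and w: "w \<in> rcll_paths T" and "e > 0"
    and f: "continuous_functional T f" "continuous_functional T f0" "continuous_functional T f1"
    and formula: "\<And>t v. t \<in> {0..T} \<Longrightarrow> v \<in> fv_paths T \<Longrightarrow>
       f t v = f 0 v + (LINT s:{0..t}|lborel. f0 s v)
         + stieltjes_integral t (left_lim (\<lambda>u. f1 u v)) v + jump_sum f f1 t v"
  obtains \<delta> where "\<delta> > 0" "t + \<delta> \<le> T"
    "\<And>h \<rho>. 0 < h \<Longrightarrow> h < \<delta> \<Longrightarrow> mono \<rho> \<Longrightarrow> (\<And>x. isCont \<rho> x) \<Longrightarrow>
       (\<And>x. x \<le> t \<Longrightarrow> \<rho> x = 0) \<Longrightarrow> (\<And>x. \<bar>\<rho> x\<bar> \<le> h) \<Longrightarrow>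
       \<bar>f (t + h) (\<lambda>s. stopped t w s + \<rho> s) - f t w - f0 t w * h - f1 t w * \<rho> (t + h)\<bar>
         \<le> e * (h + \<rho> (t + h))"
proof -
  have T: "0 \<le> T" "t \<in> {0..T}" using assms(1,2) by auto
  obtain d0 where d0: "d0 > 0"
    "\<And>t' w'. t' \<in> {0..T} \<Longrightarrow> w' \<in> rcll_paths T \<Longrightarrow> \<bar>t' - t\<bar> \<le> d0 \<Longrightarrow>
      (\<And>x. 0 \<le> x \<Longrightarrow> x \<le> T \<Longrightarrow> \<bar>w' (min x t') - w (min x t)\<bar> \<le> d0) \<Longrightarrow> \<bar>f0 t' w' - f0 t w\<bar> < e"
    using continuous_functionalD[OF f(2) T w \<open>e > 0\<close>] by metis
  obtain d1 where d1: "d1 > 0"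
    "\<And>t' w'. t' \<in> {0..T} \<Longrightarrow> w' \<in> rcll_paths T \<Longrightarrow> \<bar>t' - t\<bar> \<le> d1 \<Longrightarrow>
      (\<And>x. 0 \<le> x \<Longrightarrow> x \<le> T \<Longrightarrow> \<bar>w' (min x t') - w (min x t)\<bar> \<le> d1) \<Longrightarrow> \<bar>f1 t' w' - f1 t w\<bar> < e"
    using continuous_functionalD[OF f(3) T w \<open>e > 0\<close>] by metis
  (* Half of the moduli is reserved for the distance of the approximating step path. *)
  define \<delta> where "\<delta> = min (min d0 d1 / 2) (T - t)"
  have \<delta>: "\<delta> > 0" "t + \<delta> \<le> T" using d0(1) d1(1) assms(2) by (auto simp: \<delta>_def)
  have wt: "stopped t w \<in> rcll_paths T"
    using T by (intro rcll_path_stopped[OF w]) auto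
  have est: "\<bar>f (t + h) (\<lambda>s. stopped t w s + \<rho> s) - f t w - f0 t w * h - f1 t w * \<rho> (t + h)\<bar>
         \<le> e * (h + \<rho> (t + h)) + \<kappa>"
    if h: "0 < h" "h < \<delta>" and \<rho>: "mono \<rho>" "\<And>x. isCont \<rho> x" "\<And>x. x \<le> t \<Longrightarrow> \<rho> x = 0"
      "\<And>x. \<bar>\<rho> x\<bar> \<le> h" and "\<kappa> > 0" for h \<rho> \<kappa>
  proof -
    have th: "t + h \<in> {0..T}" using h \<delta> assms(1) by auto
    have w\<rho>: "(\<lambda>s. stopped t w s + \<rho> s) \<in> rcll_paths T"
      by (intro rcll_path_add wt rcll_path_continuous \<rho>(2))
    have "\<kappa> / 2 > 0" using \<open>\<kappa> > 0\<close> by simp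
    obtain d2 where d2: "d2 > 0"
      "\<And>t' w'. t' \<in> {0..T} \<Longrightarrow> w' \<in> rcll_paths T \<Longrightarrow> \<bar>t' - (t + h)\<bar> \<le> d2 \<Longrightarrow>
        (\<And>x. 0 \<le> x \<Longrightarrow> x \<le> T \<Longrightarrow> \<bar>w' (min x t') - (stopped t w (min x (t + h)) + \<rho> (min x (t + h)))\<bar> \<le> d2) \<Longrightarrow>
        \<bar>f t' w' - f (t + h) (\<lambda>s. stopped t w s + \<rho> s)\<bar> < \<kappa> / 2"
      using continuous_functionalD[OF f(1) T(1) th w\<rho> \<open>\<kappa> / 2 > 0\<close>] by blast
    obtain d3 where d3: "d3 > 0"
      "\<And>t' w'. t' \<in> {0..T} \<Longrightarrow> w' \<in> rcll_paths T \<Longrightarrow> \<bar>t' - t\<bar> \<le> d3 \<Longrightarrow>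
        (\<And>x. 0 \<le> x \<Longrightarrow> x \<le> T \<Longrightarrow> \<bar>w' (min x t') - w (min x t)\<bar> \<le> d3) \<Longrightarrow> \<bar>f t' w' - f t w\<bar> < \<kappa> / 2"
      using continuous_functionalD[OF f(1) T w \<open>\<kappa> / 2 > 0\<close>] by metis
    (* d0 and d1 enter so that f0 and f1 stay close to their values at (t,w) along the step path;
       d2 and d3 enter so that the two values of f move by less than half of \<kappa>. *)
    define \<eta> where "\<eta> = min (min (d0 / 2) (d1 / 2)) (min d2 d3)"
    have "\<eta> > 0" using d0(1) d1(1) d2(1) d3(1) by (simp add: \<eta>_def)
    obtain G u where u: "step_path G u" "\<And>s. 0 \<le> s \<Longrightarrow> s \<le> T \<Longrightarrow> \<bar>u s - w s\<bar> < \<eta>"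
      using rcll_path_step_approx[OF w T(1) \<open>\<eta> > 0\<close>] by metis
    define F where "F = G \<inter> {..t}"
    define v where "v = (\<lambda>s. stopped t u s + \<rho> s)"
    have step: "step_path F (stopped t u)"
      unfolding F_def by (rule step_path_stopped[OF u(1)])
    (* Stopping at t leaves break points only up to t, so v is continuous on (t,T]. *)
    have v: "tame_path T F v"
      unfolding v_def by (rule tame_step_plus_monotone[OF step \<rho>(1,2) T(1)])
    have vfv: "v \<in> fv_paths T" and vrcll: "v \<in> rcll_paths T"
      using v by (auto simp: tame_path_def fv_paths_def)
    have uw: "\<bar>u (min x t) - w (min x t)\<bar> \<le> \<eta>" if "0 \<le> x" "x \<le> T" for x
      using u(2)[of "min x t"] that T(2) by (simp add: min_le_iff_disj less_imp_le)
    have close: "\<bar>v (min x y) - w (min x t)\<bar> \<le> \<eta> + h" if "0 \<le> x" "x \<le> T" "t \<le> y" for x y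
    proof -
      have "stopped t u (min x y) = u (min x t)"
        using that(3) by (simp add: stopped_def min.assoc)
      then show ?thesis using uw[OF that(1,2)] \<rho>(4)[of "min x y"] unfolding v_def by linarith
    qed
    have small: "\<eta> + h \<le> d0" "\<eta> + h \<le> d1" "\<eta> \<le> d2" "\<eta> \<le> d3" "h \<le> d0" "h \<le> d1"
      using h(2) d0(1) d1(1) by (auto simp: \<eta>_def \<delta>_def)
    have "v (t + h) - v t = \<rho> (t + h)"
      using h(1) \<rho>(3)[of t] by (simp add: v_def stopped_def)
    moreover have "\<bar>f (t + h) v - f t v - f0 t w * (t + h - t) - f1 t w * (v (t + h) - v t)\<bar>
        \<le> e * ((t + h - t) + (v (t + h) - v t))"
    proof (rule functional_increment_estimate[OF f v formula[OF _ vfv]])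
      show "F \<inter> {t<..t + h} = {}" by (auto simp: F_def)
      show "mono_on {t..t + h} v"
        using \<rho>(1) by (auto simp: v_def stopped_def monotone_on_def)
      show "\<bar>f0 x v - f0 t w\<bar> \<le> e" if "x \<in> {t<..t + h}" for x
      proof (rule less_imp_le[OF d0(2)[OF _ vrcll]])
        show "\<bar>v (min y x) - w (min y t)\<bar> \<le> d0" if "0 \<le> y" "y \<le> T" for y
          using order_trans[OF close small(1)] that \<open>x \<in> {t<..t + h}\<close> by simp
      qed (use that th T small in auto)
      show "\<bar>f1 x v - f1 t w\<bar> \<le> e" if "x \<in> {t<..t + h}" for x
      proof (rule less_imp_le[OF d1(2)[OF _ vrcll]])
        show "\<bar>v (min y x) - w (min y t)\<bar> \<le> d1" if "0 \<le> y" "y \<le> T" for y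
          using order_trans[OF close small(2)] that \<open>x \<in> {t<..t + h}\<close> by simp
      qed (use that th T small in auto)
    qed (use th T h in auto)
    ultimately have "\<bar>f (t + h) v - f t v - f0 t w * h - f1 t w * \<rho> (t + h)\<bar> \<le> e * (h + \<rho> (t + h))"
      by simp
    moreover have "\<bar>f (t + h) v - f (t + h) (\<lambda>s. stopped t w s + \<rho> s)\<bar> < \<kappa> / 2"
    proof (rule d2(2)[OF th vrcll])
      fix x assume "0 \<le> x" "x \<le> T"
      have "stopped t g (min x (t + h)) = g (min x t)" for g
        using h(1) by (simp add: stopped_def min.assoc)
      then show "\<bar>v (min x (t + h)) - (stopped t w (min x (t + h)) + \<rho> (min x (t + h)))\<bar> \<le> d2"
        using uw[OF \<open>0 \<le> x\<close> \<open>x \<le> T\<close>] small(3) by (simp add: v_def)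
    qed (use d2(1) in simp)
    moreover have "\<bar>f t v - f t w\<bar> < \<kappa> / 2"
    proof (rule d3(2)[OF T(2) vrcll])
      fix x assume "0 \<le> x" "x \<le> T"
      then show "\<bar>v (min x t) - w (min x t)\<bar> \<le> d3"
        using uw[OF \<open>0 \<le> x\<close> \<open>x \<le> T\<close>] small(4) \<rho>(3)[of "min x t"] by (simp add: v_def stopped_def)
    qed (use d3(1) in simp)
    ultimately show ?thesis by linarith
  qed
  show ?thesis
  proof (rule that[OF \<delta>])
    show "\<bar>f (t + h) (\<lambda>s. stopped t w s + \<rho> s) - f t w - f0 t w * h - f1 t w * \<rho> (t + h)\<bar>
        \<le> e * (h + \<rho> (t + h))"
      if "0 < h" "h < \<delta>" "mono \<rho>" "\<And>x. isCont \<rho> x" "\<And>x. x \<le> t \<Longrightarrow> \<rho> x = 0" "\<And>x. \<bar>\<rho> x\<bar> \<le> h" for h \<rho>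
      by (rule field_le_epsilon, rule est[OF that])
  qed
qed

theorem proposition1:
  fixes T :: real and f f0 f1 :: path_functional
  assumes "T > 0"
    and "continuous_functional T f"
    and "continuous_functional T f0"
    and "continuous_functional T f1"
    and "\<forall>w\<in>fv_paths T. \<forall>t\<in>{0..T}. jump_remainder f f1 w summable_on {0..t}"
    and "\<forall>w\<in>fv_paths T. finite_variation_on 0 T (\<lambda>t. jump_sum f f1 t w)"
    and "\<forall>t\<in>{0..T}. \<forall>w\<in>fv_paths T.
           f t w = f 0 w + (LINT s:{0..t}|lborel. f0 s w)
                 + stieltjes_integral t (left_lim (\<lambda>u. f1 u w)) w
                 + jump_sum f f1 t w"
  shows "\<forall>t\<in>{0..<T}. \<forall>w\<in>rcll_paths T.
           has_horizontal_derivative f (f0 t w) t w \<and> has_path_derivative T f (f1 t w) t w"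
proof (intro ballI conjI)
  fix t w assume t: "t \<in> {0..<T}" and w: "w \<in> rcll_paths T"
  (* On [0,T] this is the ramp of the path derivative; unlike the latter it is monotone and
     continuous on the whole line. *)
  define r where "r h = (\<lambda>s. max 0 (min (s - t) h))" for h :: real
  have r: "mono (r h)" "isCont (r h) x" "x \<le> t \<Longrightarrow> r h x = 0" "\<bar>r h x\<bar> \<le> h" if "h > 0" for h x
    using that by (auto simp: r_def monotone_on_def intro!: continuous_intros)
  have wt: "stopped t w \<in> rcll_paths T"
    using t by (intro rcll_path_stopped[OF w]) auto
  have ramp: "f (t + h) (\<lambda>s. stopped t w s + ramp T t h s) = f (t + h) (\<lambda>s. stopped t w s + r h s)"
    if h: "h > 0" "t + h \<le> T" for h
  proof -
    have eq: "r h s = ramp T t h s" if "s \<le> T" for s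
      using h that by (auto simp: r_def ramp_def indicator_def)
    have "(\<lambda>s. stopped t w s + r h s) \<in> rcll_paths T"
      using h by (intro rcll_path_add wt rcll_path_continuous r)
    moreover from this have "(\<lambda>s. stopped t w s + ramp T t h s) \<in> rcll_paths T"
      by (rule rcll_path_cong) (simp add: eq)
    ultimately show ?thesis
      using t h eq by (intro functional_nonanticipative[OF assms(2)]) auto
  qed
  have formula: "\<And>t v. t \<in> {0..T} \<Longrightarrow> v \<in> fv_paths T \<Longrightarrow>
      f t v = f 0 v + (LINT s:{0..t}|lborel. f0 s v)
        + stieltjes_integral t (left_lim (\<lambda>u. f1 u v)) v + jump_sum f f1 t v"
    by (rule assms(7)[rule_format])
  (* The two lines are the cases of the perturbation 0 and of the ramp. *)
  have est: "\<forall>\<^sub>F h in at_right 0. h > 0 \<and> t + h \<le> T \<and>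
      \<bar>f (t + h) (stopped t w) - f t w - f0 t w * h\<bar> \<le> e * h \<and>
      \<bar>f (t + h) (\<lambda>s. stopped t w s + r h s) - f t w - f0 t w * h - f1 t w * h\<bar> \<le> 2 * e * h"
    if "e > 0" for e
  proof -
    have t': "0 \<le> t" "t < T" using t by auto
    obtain \<delta> where \<delta>: "\<delta> > 0" "t + \<delta> \<le> T"
      "\<And>h \<rho>. 0 < h \<Longrightarrow> h < \<delta> \<Longrightarrow> mono \<rho> \<Longrightarrow> (\<And>x. isCont \<rho> x) \<Longrightarrow>
        (\<And>x. x \<le> t \<Longrightarrow> \<rho> x = 0) \<Longrightarrow> (\<And>x. \<bar>\<rho> x\<bar> \<le> h) \<Longrightarrow>
        \<bar>f (t + h) (\<lambda>s. stopped t w s + \<rho> s) - f t w - f0 t w * h - f1 t w * \<rho> (t + h)\<bar>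
          \<le> e * (h + \<rho> (t + h))"
      using rcll_path_increment_estimate[OF t' w \<open>e > 0\<close> assms(2-4) formula] by blast
    have "\<forall>\<^sub>F h in at_right 0. h \<in> {0<..<\<delta>}"
      by (intro eventually_at_right_real \<delta>)
    then show ?thesis
    proof eventually_elim
      case (elim h)
      then have h: "0 < h" "h < \<delta>" by auto
      have "\<bar>f (t + h) (\<lambda>s. stopped t w s + 0) - f t w - f0 t w * h - f1 t w * 0\<bar> \<le> e * (h + 0)"
        by (rule \<delta>(3)[OF h]) (use h in \<open>auto simp: monotone_on_def\<close>)
      moreover have "r h (t + h) = h" using h by (simp add: r_def)
      moreover note \<delta>(3)[OF h r[OF h(1)]]
      ultimately show ?case using h \<delta>(2) by (simp add: algebra_simps)
    qed
  qed
  show "has_horizontal_derivative f (f0 t w) t w"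
    unfolding has_horizontal_derivative_def
  proof (rule tendstoI)
    fix e :: real assume "e > 0"
    then have "e / 2 > 0" by simp
    from est[OF this]
    show "\<forall>\<^sub>F h in at_right 0. dist ((f (t + h) (stopped t w) - f t w) / h) (f0 t w) < e"
    proof eventually_elim
      case (elim h)
      have "(f (t + h) (stopped t w) - f t w) / h - f0 t w
          = (f (t + h) (stopped t w) - f t w - f0 t w * h) / h"
        using elim by (simp add: field_simps)
      also have "\<bar>\<dots>\<bar> \<le> e / 2"
        using elim by (simp add: abs_divide divide_le_eq)
      finally show ?case using \<open>e > 0\<close> by (simp add: dist_real_def)
    qed
  qed
  show "has_path_derivative T f (f1 t w) t w"
    unfolding has_path_derivative_def
  proof (rule tendstoI)
    fix e :: real assume "e > 0"
    then have "e / 4 > 0" by simp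
    from est[OF this]
    show "\<forall>\<^sub>F h in at_right 0. dist ((f (t + h) (\<lambda>s. stopped t w s + ramp T t h s)
        - f (t + h) (stopped t w)) / h) (f1 t w) < e"
    proof eventually_elim
      case (elim h)
      let ?A = "f (t + h) (\<lambda>s. stopped t w s + r h s)" and ?B = "f (t + h) (stopped t w)"
      have "(?A - ?B) / h - f1 t w = (?A - ?B - f1 t w * h) / h"
        using elim by (simp add: field_simps)
      also have "\<bar>?A - ?B - f1 t w * h\<bar> \<le> 3 * (e / 4) * h"
        using elim by linarith
      then have "\<bar>(?A - ?B - f1 t w * h) / h\<bar> \<le> 3 * (e / 4)"
        using elim by (simp add: abs_divide divide_le_eq)
      finally have "\<bar>(?A - ?B) / h - f1 t w\<bar> \<le> 3 * (e / 4)" .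
      then show ?case using \<open>e > 0\<close> elim by (simp add: dist_real_def ramp)
    qed
  qed
qed

end
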